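(* Let $0<\rho<1$, let $\Omega=\{z\in\mathbb{C}:\rho<|z|<1\}$ be the annulus with boundary $\Gamma$, and let $S(z,a)$ be the Szegő kernel for $\Omega$. Then for all $a\in\Omega$ and $z\in\Omega\cup\Gamma$, $$S(z,a)=\frac{1}{2\pi(1+\rho)}\;{}_1\psi_1(-\rho;-\rho^3;\rho^2;\overline{a}z)$$ and $$S(z,a)=\frac{1}{2\pi}\prod_{n=0}^{\infty}\frac{(1+\overline{a}z\rho^{2n+1})(\overline{a}z+\rho^{2n+1})(1-\rho^{2n+2})^2}{(1-\overline{a}z\rho^{2n})(\overline{a}z-\rho^{2n+2})(1+\rho^{2n+1})^2}.$$ Moreover, for each $a\in\Omega$, the zero of $S(\cdot,a)$ in $\Omega$ is the zero of the factor $\overline{a}z+\rho$, that is, $z=-\rho/\overline{a}$ (this is the one and only zero of $S(\cdot,a)$ in $\Omega$).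
   Context: The Szegő kernel $S(z,a)$ for $\Omega$ is the reproducing kernel of the Hardy space $H^2(\Gamma)$, where $\Gamma$ consists of the circles $|z|=1$ and $|z|=\rho$ and the inner product is $\langle f,g\rangle=\int_\Gamma f\,\overline{g}\,|dz|$ with $|dz|$ arc length measure. An orthonormal basis of $H^2(\Gamma)$ is $\{z^n/\sqrt{2\pi(1+\rho^{2n+1})}\}_{n\in\mathbb{Z}}$, so that (known) $$S(z,a)=\frac{1}{2\pi}\sum_{n=-\infty}^{\infty}\frac{(z\overline{a})^n}{1+\rho^{2n+1}},\qquad a\in\Omega,\ z\in\Omega\cup\Gamma.$$ For $0<q<1$ and $\alpha\in\mathbb{C}$ the $q$-shifted factorial is $(\alpha;q)_0=1$, $(\alpha;q)_n=\prod_{k=0}^{n-1}(1-\alpha q^k)$ for $n\ge1$, and $(\alpha;q)_n=\prod_{k=1}^{|n|}(1-\alpha q^{-k})^{-1}$ for $n\le-1$. The bilateral basic hypergeometric series is $${}_1\psi_1(\alpha;\beta;q;z)=\sum_{n=-\infty}^{\infty}\frac{(\alpha;q)_n}{(\beta;q)_n}z^n,\qquad |\beta/\alpha|<|z|<1.$$ *)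

theory Defs
  imports "HOL-Complex_Analysis.Complex_Analysis"
begin

definition annulus :: "real \<Rightarrow> complex set" where
  "annulus \<rho> = {z. \<rho> < norm z \<and> norm z < 1}"

definition annulus_boundary :: "real \<Rightarrow> complex set" where
  "annulus_boundary \<rho> = sphere 0 1 \<union> sphere 0 \<rho>"

text \<open>
  Integration over the boundary with respect to arc length. The circle of radius \<open>r\<close> is
  parametrised by \<open>r * cis t\<close> for \<open>0 \<le> t \<le> 2 * pi\<close>, so that \<open>|dz| = r dt\<close>.
\<close>

definition arc_integral ::
    "real \<Rightarrow> (complex \<Rightarrow> 'a :: {banach, second_countable_topology}) \<Rightarrow> 'a" where
  "arc_integral \<rho> g =
     (LINT t | lebesgue_on {0..2*pi}. g (cis t)) +
     \<rho> *\<^sub>R (LINT t | lebesgue_on {0..2*pi}. g (of_real \<rho> * cis t))"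

definition boundary_inner :: "real \<Rightarrow> (complex \<Rightarrow> complex) \<Rightarrow> (complex \<Rightarrow> complex) \<Rightarrow> complex" where
  "boundary_inner \<rho> f g = arc_integral \<rho> (\<lambda>z. f z * cnj (g z))"

definition boundary_L2 :: "real \<Rightarrow> (complex \<Rightarrow> complex) set" where
  "boundary_L2 \<rho> = {f. \<forall>r\<in>{1, \<rho>}.
     (\<lambda>t. f (of_real r * cis t)) \<in> borel_measurable (lebesgue_on {0..2*pi}) \<and>
     integrable (lebesgue_on {0..2*pi}) (\<lambda>t. (norm (f (of_real r * cis t)))\<^sup>2)}"

text \<open>
  The Hardy space is the closure, in \<open>L\<^sup>2\<close> of the boundary, of the functions that are
  continuous on the closed annulus and holomorphic inside. An element is represented by its
  boundary function together with its holomorphic extension to the annulus, as a single function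
  on the closed annulus. The boundary function determines the extension: \<open>L\<^sup>2\<close> convergence on
  the boundary forces, by Cauchy's formula, locally uniform convergence inside, so the pointwise
  limit required below always exists and is the Cauchy integral of the boundary function.
  Functions that agree almost everywhere on the boundary represent the same element; values
  outside the closed annulus are irrelevant.
\<close>

definition hardy_space :: "real \<Rightarrow> (complex \<Rightarrow> complex) set" where
  "hardy_space \<rho> = {f. f holomorphic_on annulus \<rho> \<and> f \<in> boundary_L2 \<rho> \<and>
     (\<exists>F :: nat \<Rightarrow> complex \<Rightarrow> complex.
        (\<forall>n. continuous_on (annulus \<rho> \<union> annulus_boundary \<rho>) (F n) \<and>
             F n holomorphic_on annulus \<rho>) \<and>
        (\<lambda>n. arc_integral \<rho> (\<lambda>z. (norm (F n z - f z))\<^sup>2)) \<longlonglongrightarrow> 0 \<and>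
        (\<forall>z\<in>annulus \<rho>. (\<lambda>n. F n z) \<longlonglongrightarrow> f z))}"

definition represents_evaluation :: "real \<Rightarrow> complex \<Rightarrow> (complex \<Rightarrow> complex) \<Rightarrow> bool" where
  "represents_evaluation \<rho> a k \<longleftrightarrow>
     k \<in> hardy_space \<rho> \<and> (\<forall>f\<in>hardy_space \<rho>. f a = boundary_inner \<rho> f k)"

text \<open>
  The reproducing kernel. As an element of the Hardy space its boundary values are only determined
  almost everywhere; the value at a boundary point is that of the representative which is
  continuous on the closed annulus.
\<close>

definition szego_kernel :: "real \<Rightarrow> complex \<Rightarrow> complex \<Rightarrow> complex" where
  "szego_kernel \<rho> z a = (THE w. \<exists>k. represents_evaluation \<rho> a k \<and>
     continuous_on (annulus \<rho> \<union> annulus_boundary \<rho>) k \<and> w = k z)"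

definition qshift :: "complex \<Rightarrow> real \<Rightarrow> int \<Rightarrow> complex" where
  "qshift \<alpha> q n =
     (if n \<ge> 0 then (\<Prod>k<nat n. 1 - \<alpha> * of_real q ^ k)
      else (\<Prod>k=1..nat \<bar>n\<bar>. inverse (1 - \<alpha> * of_real q powi (- int k))))"

definition psi11_term :: "complex \<Rightarrow> complex \<Rightarrow> real \<Rightarrow> complex \<Rightarrow> int \<Rightarrow> complex" where
  "psi11_term \<alpha> \<beta> q z n = qshift \<alpha> q n / qshift \<beta> q n * z powi n"

definition psi11 :: "complex \<Rightarrow> complex \<Rightarrow> real \<Rightarrow> complex \<Rightarrow> complex" where
  "psi11 \<alpha> \<beta> q z = (\<Sum>\<^sub>\<infinity>n\<in>UNIV. psi11_term \<alpha> \<beta> q z n)"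

definition szego_factor :: "real \<Rightarrow> complex \<Rightarrow> nat \<Rightarrow> complex" where
  "szego_factor \<rho> x n =
     ((1 + x * of_real \<rho> ^ (2*n+1)) * (x + of_real \<rho> ^ (2*n+1)) * (1 - of_real \<rho> ^ (2*n+2))\<^sup>2) /
     ((1 - x * of_real \<rho> ^ (2*n)) * (x - of_real \<rho> ^ (2*n+2)) * (1 + of_real \<rho> ^ (2*n+1))\<^sup>2)"

end

theory Submission
  imports Defs
begin

text \<open>
  With \<open>x = cnj a * z\<close> everything reduces to the function
  \<open>A x = (\<Sum>\<^sub>\<infinity>n. x powi n / (1 + \<rho> powi (2 * n + 1)))\<close> on \<open>\<rho>\<^sup>2 < norm x < 1\<close>, called
  \<open>szego_series\<close> below: the kernel is \<open>A x / (2 * pi)\<close>, the hypergeometric series is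
  \<open>(1 + \<rho>) * A x\<close>, and the infinite product is a product formula for \<open>A\<close>.

  The kernel. If \<open>F\<close> is continuous on the closed annulus and holomorphic inside, with Laurent
  coefficients \<open>c n\<close>, then the \<open>n\<close>-th term of the series for the candidate kernel, paired with \<open>F\<close>,
  contributes \<open>c n * a powi n\<close> times \<open>1 / (1 + \<rho> powi (2 * n + 1))\<close> over the unit circle, and the
  same times \<open>\<rho> powi (2 * n + 1)\<close> over the inner circle. The two weights add up to 1, so the pairing
  is the Laurent series of \<open>F\<close> at \<open>a\<close> (\<open>szego_candidate_reproduces_continuous\<close>). The identity
  extends to the whole Hardy space because the candidate is bounded on the boundary and
  \<open>L\<^sup>2\<close> convergence there implies \<open>L\<^sup>1\<close> convergence. A continuous representer is unique: the
  difference of two of them is orthogonal to itself, hence zero on the boundary, hence zero inside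
  by the reproducing property just obtained.

  The product. Splitting off the geometric series \<open>\<Sum>n\<ge>0. x ^ n\<close> continues \<open>A\<close> past the unit
  circle as \<open>1 / (1 - x) + B x\<close>, with \<open>B\<close> holomorphic for \<open>\<rho>\<^sup>2 < norm x < 1 / \<rho>\<^sup>2\<close>; the identity
  \<open>1 / (1 + t) + t / (1 + t) = 1\<close> turns into the functional equation
  \<open>\<rho> * A (\<rho>\<^sup>2 * x) = - A x\<close> of this continuation. Let \<open>\<theta>\<close> be the theta product for the base
  \<open>\<rho>\<^sup>2\<close>. The functions \<open>g = A * \<theta>\<close> (the simple zero of \<open>\<theta>\<close> at 1 cancels the pole) and
  \<open>N x = \<theta> (- \<rho> * x)\<close> are then both multiplied by \<open>1 / (\<rho> * x)\<close> when \<open>x\<close> is replaced by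
  \<open>\<rho>\<^sup>2 * x\<close>. Such a function has Laurent coefficients \<open>c 0 * \<rho> powi (n\<^sup>2)\<close>, and its value at 1 is
  \<open>c 0\<close> times a positive number, so it vanishes identically as soon as it vanishes at 1
  (\<open>quasi_periodic_determined_at_1\<close>). Applied to \<open>g 1 * N - N 1 * g\<close> this gives
  \<open>A = (g 1 / N 1) * N / \<theta>\<close>, which is the product. Its only factor that vanishes for
  \<open>\<rho>\<^sup>2 < norm x < 1\<close> is the one containing \<open>x + \<rho>\<close>.
\<close>

section \<open>Circle means and Laurent expansions on a ring\<close>

definition circle_mean :: "real \<Rightarrow> (complex \<Rightarrow> complex) \<Rightarrow> complex" where
  "circle_mean r f = integral {0..2*pi} (\<lambda>t. f (of_real r * cis t)) / (2 * of_real pi)"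

definition open_ring :: "real \<Rightarrow> real \<Rightarrow> complex set" where
  "open_ring r s = {z. r < norm z \<and> norm z < s}"

definition closed_ring :: "real \<Rightarrow> real \<Rightarrow> complex set" where
  "closed_ring r s = {z. r \<le> norm z \<and> norm z \<le> s}"

lemma open_open_ring: "open (open_ring r s)"
proof -
  have "open_ring r s = ball 0 s - cball 0 r"
    by (auto simp: open_ring_def)
  then show ?thesis by (simp add: open_Diff)
qed

lemma continuous_on_circle:
  assumes "continuous_on (sphere 0 r) f" "r \<ge> 0"
  shows "continuous_on A (\<lambda>t. f (of_real r * cis t))"
  by (rule continuous_on_compose2[OF assms(1)])
     (use assms(2) in \<open>auto intro!: continuous_intros simp: norm_mult\<close>)

lemma bounded_on_circle:
  fixes f :: "complex \<Rightarrow> complex"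
  assumes "continuous_on (sphere 0 r) f"
  obtains C where "\<And>z. norm z = r \<Longrightarrow> norm (f z) \<le> C"
proof -
  have "bounded (f ` sphere 0 r)"
    by (intro compact_imp_bounded compact_continuous_image assms compact_sphere)
  then obtain C where "\<forall>w\<in>f ` sphere 0 r. norm w \<le> C" unfolding bounded_iff by blast
  then have "norm (f z) \<le> C" if "norm z = r" for z using that by simp
  then show thesis by (rule that)
qed

lemma circle_mean_cong:
  assumes "\<And>z. norm z = r \<Longrightarrow> f z = g z" "r \<ge> 0"
  shows "circle_mean r f = circle_mean r g"
proof -
  have "f (of_real r * cis t) = g (of_real r * cis t)" for t
    by (rule assms(1)) (use assms(2) in \<open>simp add: norm_mult\<close>)
  then show ?thesis by (simp add: circle_mean_def)
qed

lemma circle_mean_diff: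
  assumes "continuous_on (sphere 0 r) f" "continuous_on (sphere 0 r) g" "r \<ge> 0"
  shows "circle_mean r (\<lambda>z. f z - g z) = circle_mean r f - circle_mean r g"
  unfolding circle_mean_def
  by (subst integral_diff)
     (auto intro!: integrable_continuous_real continuous_on_circle assms simp: diff_divide_distrib)

lemma circle_mean_cmult: "circle_mean r (\<lambda>z. c * f z) = c * circle_mean r f"
  unfolding circle_mean_def by simp

lemma circle_mean_eq_contour_integral:
  assumes "r > 0"
  shows "circle_mean r f = contour_integral (circlepath 0 r) (\<lambda>z. f z / z) / (2 * of_real pi * \<i>)"
proof -
  have "contour_integral (circlepath 0 r) (\<lambda>z. f z / z) =
        integral {0..2*pi} (\<lambda>t. f (of_real r * cis t) / (of_real r * cis t) * of_real r * \<i> * cis t)"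
    unfolding circlepath_def by (subst contour_integral_part_circlepath_eq) auto
  also have "\<dots> = integral {0..2*pi} (\<lambda>t. \<i> * f (of_real r * cis t))"
    by (rule arg_cong[where f = "integral _"]) (use assms in \<open>auto simp: fun_eq_iff\<close>)
  finally show ?thesis by (simp add: circle_mean_def)
qed

text \<open>
  The contour integral of \<open>f z / z\<close> does not change under the radial homotopy between two circles
  inside the ring; continuity of the mean in the radius carries this to the two boundary circles,
  where \<open>f\<close> need not be holomorphic.
\<close>

lemma circle_mean_const_on_ring:
  assumes cont: "continuous_on (closed_ring r s) f" and holo: "f holomorphic_on open_ring r s"
    and "0 < r" "r < s"
  shows "circle_mean r f = circle_mean s f"
proof -
  have eq: "circle_mean u f = circle_mean v f" if uv: "r < u" "u \<le> v" "v < s" for u v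
  proof -
    have "contour_integral (circlepath 0 u) (\<lambda>z. f z / z) = contour_integral (circlepath 0 v) (\<lambda>z. f z / z)"
    proof (rule Cauchy_theorem_homotopic_loops)
      show "homotopic_loops (open_ring r s) (circlepath 0 u) (circlepath 0 v)"
      proof (rule homotopic_loops_linear)
        fix t :: real
        show "closed_segment (circlepath 0 u t) (circlepath 0 v t) \<subseteq> open_ring r s"
        proof
          fix z assume "z \<in> closed_segment (circlepath 0 u t) (circlepath 0 v t)"
          then obtain x where x: "0 \<le> x" "x \<le> 1"
            "z = (1 - x) *\<^sub>R circlepath 0 u t + x *\<^sub>R circlepath 0 v t"
            by (auto simp: closed_segment_def)
          have "z = of_real ((1 - x) * u + x * v) * exp (2 * of_real pi * \<i> * of_real t)"
            using x(3) by (simp add: circlepath scaleR_conv_of_real algebra_simps)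
          moreover have "norm (exp (2 * of_real pi * \<i> * of_real t)) = 1"
            by (simp add: norm_exp_eq_Re)
          ultimately have "norm z = \<bar>(1 - x) * u + x * v\<bar>"
            by (simp only: norm_mult norm_of_real mult_1_right)
          moreover have "(1 - x) * u + x * v \<ge> u" "(1 - x) * u + x * v \<le> v"
            using x uv mult_left_mono[of u v x] mult_left_mono[of u v "1 - x"]
            by (auto simp: algebra_simps)
          ultimately show "z \<in> open_ring r s"
            using uv \<open>0 < r\<close> by (auto simp: open_ring_def)
        qed
      qed auto
      show "(\<lambda>z. f z / z) holomorphic_on open_ring r s"
        using \<open>0 < r\<close> by (intro holomorphic_intros holo) (auto simp: open_ring_def)
    qed (auto simp: open_open_ring)
    then show ?thesis
      using uv \<open>0 < r\<close> by (simp add: circle_mean_eq_contour_integral)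
  qed
  have contM: "continuous_on {r..s} (\<lambda>u. circle_mean u f)"
  proof -
    have "continuous_on ({r..s} \<times> cbox 0 (2*pi)) (\<lambda>(u, t). f (of_real u * cis t))"
      unfolding split_def
      by (rule continuous_on_compose2[OF cont])
         (use \<open>0 < r\<close> in \<open>auto intro!: continuous_intros simp: closed_ring_def norm_mult\<close>)
    from integral_continuous_on_param[OF this] show ?thesis
      unfolding circle_mean_def by (auto intro!: continuous_intros)
  qed
  define m where "m = (r + s) / 2"
  have "circle_mean x f = circle_mean m f" if "x \<in> {r..s}" for x
  proof (rule continuous_constant_on_closure[where S = "{r<..<s}"])
    show "continuous_on (closure {r<..<s}) (\<lambda>u. circle_mean u f)"
      using contM \<open>r < s\<close> by simp
    show "x \<in> closure {r<..<s}" using that \<open>r < s\<close> by simp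
    show "circle_mean y f = circle_mean m f" if "y \<in> {r<..<s}" for y
    proof (cases "y \<le> m")
      case True
      then show ?thesis using eq[of y m] that \<open>r < s\<close> by (simp add: m_def)
    next
      case False
      then show ?thesis using eq[of m y] that \<open>r < s\<close> by (simp add: m_def)
    qed
  qed
  from this[of r] this[of s] show ?thesis using \<open>r < s\<close> by simp
qed

lemma circle_mean_Cauchy_kernel_inside:
  assumes "norm a < r"
  shows "circle_mean r (\<lambda>z. z / (z - a)) = 1"
proof -
  have r: "r > 0" using assms norm_ge_zero[of a] by linarith
  have "((\<lambda>u. 1 / (u - a)) has_contour_integral (2 * of_real pi * \<i> * 1)) (circlepath 0 r)"
    by (rule Cauchy_integral_circlepath_simple) (use assms in auto)
  moreover have "contour_integral (circlepath 0 r) (\<lambda>z. z / (z - a) / z) =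
      contour_integral (circlepath 0 r) (\<lambda>u. 1 / (u - a))"
    by (rule contour_integral_eq) (use r in auto)
  ultimately show ?thesis
    using r by (simp add: circle_mean_eq_contour_integral contour_integral_unique)
qed

lemma circle_mean_Cauchy_kernel_outside:
  assumes "0 < r" "r < norm a"
  shows "circle_mean r (\<lambda>z. z / (z - a)) = 0"
proof -
  have "((\<lambda>u. 1 / (u - a)) has_contour_integral 0) (circlepath 0 r)"
    by (rule Cauchy_theorem_disc_simple[of _ 0 "norm a"])
       (use assms in \<open>auto intro!: holomorphic_intros\<close>)
  moreover have "contour_integral (circlepath 0 r) (\<lambda>z. z / (z - a) / z) =
      contour_integral (circlepath 0 r) (\<lambda>u. 1 / (u - a))"
    by (rule contour_integral_eq) (use assms in auto)
  ultimately show ?thesis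
    using assms by (simp add: circle_mean_eq_contour_integral contour_integral_unique)
qed

text \<open>
  Both boundary circles have the same mean of \<open>z * (f z - f a) / (z - a)\<close>, whose singularity at
  \<open>a\<close> is removable. The subtracted term \<open>f a * (z / (z - a))\<close> has mean \<open>f a\<close> on the outer
  circle and mean 0 on the inner one.
\<close>

lemma Cauchy_formula_ring:
  assumes cont: "continuous_on (closed_ring r s) f" and holo: "f holomorphic_on open_ring r s"
    and "0 < r" and a: "a \<in> open_ring r s"
  shows "f a = circle_mean s (\<lambda>z. f z * (z / (z - a))) - circle_mean r (\<lambda>z. f z * (z / (z - a)))"
proof -
  have rs: "r < norm a" "norm a < s" using a by (auto simp: open_ring_def)
  \<comment> \<open>the difference quotient, completed at \<open>a\<close>: holomorphic inside, continuous up to the boundary\<close>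
  define h where "h = (\<lambda>z. z * (if z = a then deriv f a else (f z - f a) / (z - a)))"
  have holh: "h holomorphic_on open_ring r s"
    unfolding h_def
    by (intro holomorphic_on_mult pole_lemma_open holo open_open_ring holomorphic_on_ident)
  have "continuous_on ((closed_ring r s - {a}) \<union> open_ring r s) h"
  proof (rule continuous_on_Un_local_open)
    have un: "(closed_ring r s - {a}) \<union> open_ring r s = closed_ring r s"
      using a by (auto simp: closed_ring_def open_ring_def)
    show "openin (top_of_set (closed_ring r s - {a} \<union> open_ring r s)) (closed_ring r s - {a})"
      unfolding un by (auto simp: openin_open intro!: exI[of _ "-{a}"])
    show "openin (top_of_set (closed_ring r s - {a} \<union> open_ring r s)) (open_ring r s)"
      unfolding un using open_open_ring
      by (auto simp: openin_open open_ring_def closed_ring_def intro!: exI[of _ "open_ring r s"])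
    have "continuous_on (closed_ring r s - {a}) (\<lambda>z. z * ((f z - f a) / (z - a)))"
      by (intro continuous_intros continuous_on_subset[OF cont]) auto
    then show "continuous_on (closed_ring r s - {a}) h"
      by (rule continuous_on_eq) (auto simp: h_def)
    show "continuous_on (open_ring r s) h"
      using holh holomorphic_on_imp_continuous_on by blast
  qed
  also have "(closed_ring r s - {a}) \<union> open_ring r s = closed_ring r s"
    using a by (auto simp: closed_ring_def open_ring_def)
  finally have conth: "continuous_on (closed_ring r s) h" .
  have split: "circle_mean u h =
      circle_mean u (\<lambda>z. f z * (z / (z - a))) - f a * circle_mean u (\<lambda>z. z / (z - a))"
    if "u = r \<or> u = s" for u
  proof -
    have u: "u > 0" "u \<noteq> norm a" "sphere 0 u \<subseteq> closed_ring r s"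
      using that rs \<open>0 < r\<close> by (auto simp: closed_ring_def)
    have c: "continuous_on (sphere 0 u) (\<lambda>z. z / (z - a))"
      using u by (auto intro!: continuous_intros)
    have "circle_mean u h = circle_mean u (\<lambda>z. f z * (z / (z - a)) - f a * (z / (z - a)))"
      by (rule circle_mean_cong) (use u in \<open>auto simp: h_def diff_divide_distrib algebra_simps\<close>)
    also have "\<dots> = circle_mean u (\<lambda>z. f z * (z / (z - a))) - circle_mean u (\<lambda>z. f a * (z / (z - a)))"
      using u c by (intro circle_mean_diff continuous_on_mult continuous_on_const
          continuous_on_subset[OF cont]) auto
    finally show ?thesis by (simp only: circle_mean_cmult)
  qed
  have "circle_mean r h = circle_mean s h"
    by (rule circle_mean_const_on_ring[OF conth holh]) (use rs \<open>0 < r\<close> in auto)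
  then have "circle_mean s (\<lambda>z. f z * (z / (z - a))) - f a * 1
      = circle_mean r (\<lambda>z. f z * (z / (z - a))) - f a * 0"
    using split[of r] split[of s] rs \<open>0 < r\<close>
      circle_mean_Cauchy_kernel_inside[of a s] circle_mean_Cauchy_kernel_outside[of r a] by simp
  then show ?thesis by (simp add: algebra_simps)
qed

lemma has_sum_circle_mean:
  fixes g :: "'i \<Rightarrow> complex \<Rightarrow> complex"
  assumes "0 \<le> r"
    and cont: "\<And>n. n \<in> I \<Longrightarrow> continuous_on (sphere 0 r) (g n)"
    and bound: "\<And>n z. n \<in> I \<Longrightarrow> norm z = r \<Longrightarrow> norm (g n z) \<le> M n"
    and M: "M summable_on I"
    and sum: "\<And>z. norm z = r \<Longrightarrow> ((\<lambda>n. g n z) has_sum G z) I"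
  shows "((\<lambda>n. circle_mean r (g n)) has_sum circle_mean r G) I"
proof -
  have on: "norm (of_real r * cis t) = r" for t
    using assms(1) by (simp add: norm_mult)
  \<comment> \<open>extended by 0 outside \<open>I\<close>, so that every finite partial sum is continuous\<close>
  define h where "h n t = (if n \<in> I then g n (of_real r * cis t) else 0)" for n t
  have lim_h: "uniform_limit {0..2*pi} (\<lambda>X t. \<Sum>n\<in>X. h n t)
          (\<lambda>t. G (of_real r * cis t)) (finite_subsets_at_top I)"
  proof (rule Weierstrass_m_test_general')
    show "((\<lambda>n. h n t) has_sum G (of_real r * cis t)) I" for t
      using sum[OF on[of t]] by (subst has_sum_cong[of _ _ "\<lambda>n. g n (of_real r * cis t)"]) (auto simp: h_def)
    show "norm (h n t) \<le> M n" if "n \<in> I" for n t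
      using bound[OF that on[of t]] that by (simp add: h_def)
  qed (rule M)
  have ch: "continuous_on A (h n)" for n A
    unfolding h_def using continuous_on_circle[OF cont assms(1), of n] by (cases "n \<in> I") auto
  obtain J K where J: "\<And>X. ((\<lambda>t. \<Sum>n\<in>X. h n t) has_integral J X) {0..2*pi}"
    and K: "((\<lambda>t. G (of_real r * cis t)) has_integral K) {0..2*pi}"
    and lim: "(J \<longlongrightarrow> K) (finite_subsets_at_top I)"
    by (rule uniform_limit_integral[OF lim_h]) (auto intro!: continuous_on_sum ch)
  have "((\<lambda>n. integral {0..2*pi} (h n)) has_sum K) I"
    unfolding has_sum_def
  proof (rule Lim_transform_eventually[OF lim])
    have "J X = (\<Sum>n\<in>X. integral {0..2*pi} (h n))" if "finite X" for X
    proof -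
      have "((\<lambda>t. \<Sum>n\<in>X. h n t) has_integral (\<Sum>n\<in>X. integral {0..2*pi} (h n))) {0..2*pi}"
        by (intro has_integral_sum that integrable_integral integrable_continuous_real ch)
      with J[of X] show ?thesis by (metis has_integral_unique)
    qed
    then show "\<forall>\<^sub>F X in finite_subsets_at_top I. J X = (\<Sum>n\<in>X. integral {0..2*pi} (h n))"
      by (intro eventually_finite_subsets_at_top_weakI) auto
  qed
  then have "((\<lambda>n. integral {0..2*pi} (h n) / (2 * of_real pi)) has_sum (K / (2 * of_real pi))) I"
    by (rule has_sum_divide_const)
  also have "K / (2 * of_real pi) = circle_mean r G"
    using K by (simp add: circle_mean_def integral_unique)
  finally have "((\<lambda>n. integral {0..2*pi} (h n) / (2 * of_real pi)) has_sum circle_mean r G) I" .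
  moreover have "circle_mean r (g n) = integral {0..2*pi} (h n) / (2 * of_real pi)" if "n \<in> I" for n
  proof -
    have "h n = (\<lambda>t. g n (of_real r * cis t))" using that by (simp add: h_def fun_eq_iff)
    then show ?thesis by (simp add: circle_mean_def)
  qed
  ultimately show ?thesis
    by (metis (no_types, lifting) has_sum_cong)
qed

lemma has_sum_geometric_int_nonneg:
  fixes w :: "'a :: {real_normed_field, banach}"
  assumes "norm w < 1"
  shows "((\<lambda>n. w powi n) has_sum (1 / (1 - w))) {0..}"
proof -
  have "((\<lambda>n. w ^ n) has_sum (1 / (1 - w))) UNIV"
    by (rule norm_summable_imp_has_sum)
       (use assms geometric_sums[of w] in \<open>auto simp: norm_power intro!: summable_geometric\<close>)
  also have "?this \<longleftrightarrow> ?thesis"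
    by (intro has_sum_reindex_bij_witness[of _ nat int]) (auto simp: power_int_nonneg_exp)
  finally show ?thesis .
qed

lemma has_sum_geometric_int_neg:
  fixes w :: "'a :: {real_normed_field, banach}"
  assumes "norm w > 1"
  shows "((\<lambda>n. w powi n) has_sum (1 / (w - 1))) {..<0}"
proof -
  have "((\<lambda>n. (1 / w) ^ n) has_sum ((1 / w) / (1 - 1 / w))) {1..}"
    by (rule has_sum_geometric_from_1) (use assms in \<open>simp add: norm_divide divide_less_eq_1\<close>)
  also have "(1 / w) / (1 - 1 / w) = 1 / (w - 1)"
    using assms by (auto simp: field_simps)
  also have "((\<lambda>n. (1 / w) ^ n) has_sum (1 / (w - 1))) {1..} \<longleftrightarrow> ?thesis"
    by (intro has_sum_reindex_bij_witness[of _ "\<lambda>n. nat (-n)" "\<lambda>n. - int n"])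
       (auto simp: power_int_minus power_inverse field_simps)
  finally show ?thesis .
qed

lemma int_eq_nonneg_Un_neg: "(UNIV :: int set) = {0..} \<union> {..<0}"
  by auto

text \<open>
  In Cauchy's formula for the ring, \<open>z / (z - a)\<close> is the geometric series of \<open>(a / z) powi n\<close> over
  \<open>n \<ge> 0\<close> on the outer circle, and minus that series over \<open>n < 0\<close> on the inner circle. The
  coefficients may be taken on the outer circle throughout, since these means do not depend on the
  radius.
\<close>

lemma Laurent_expansion_ring:
  assumes cont: "continuous_on (closed_ring r s) f" and holo: "f holomorphic_on open_ring r s"
    and "0 < r" and a: "a \<in> open_ring r s"
  shows "((\<lambda>n. circle_mean s (\<lambda>z. f z * z powi (-n)) * a powi n) has_sum f a) UNIV"
proof -
  have rs: "r < norm a" "norm a < s" using a by (auto simp: open_ring_def)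
  have a0: "a \<noteq> 0" and r0: "r \<ge> 0" and s0: "s \<ge> 0" using rs \<open>0 < r\<close> by auto
  have sub: "sphere 0 r \<subseteq> closed_ring r s" "sphere 0 s \<subseteq> closed_ring r s"
    using rs by (auto simp: closed_ring_def)
  have term_eq: "a powi n * (f z * z powi (-n)) = f z * (a / z) powi n" for n z
    by (simp add: power_int_divide_distrib power_int_minus field_simps)
  have coeff: "circle_mean r (\<lambda>z. f z * z powi (-n)) = circle_mean s (\<lambda>z. f z * z powi (-n))" for n
    using \<open>0 < r\<close> rs
    by (intro circle_mean_const_on_ring continuous_intros cont holomorphic_intros holo)
       (auto simp: closed_ring_def open_ring_def)
  obtain C where C: "\<And>z. norm z = s \<Longrightarrow> norm (f z) \<le> C"
    using bounded_on_circle[OF continuous_on_subset[OF cont sub(2)]] by blast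
  obtain C' where C': "\<And>z. norm z = r \<Longrightarrow> norm (f z) \<le> C'"
    using bounded_on_circle[OF continuous_on_subset[OF cont sub(1)]] by blast
  have cont_term: "continuous_on (sphere 0 u) (\<lambda>z. f z * (a / z) powi n)"
    if "u = r \<or> u = s" for u n
  proof -
    have "sphere 0 u \<subseteq> closed_ring r s" "u > 0" using that sub rs \<open>0 < r\<close> by auto
    then show ?thesis
      by (intro continuous_on_mult continuous_on_power_int continuous_on_divide continuous_on_const
          continuous_on_id continuous_on_subset[OF cont]) (use a0 in auto)
  qed
  have "((\<lambda>n. circle_mean s (\<lambda>z. f z * (a / z) powi n)) has_sum circle_mean s (\<lambda>z. f z * (z / (z - a)))) {0..}"
  proof (rule has_sum_circle_mean[where M = "\<lambda>n. C * (norm a / s) powi n"])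
    show "norm (f z * (a / z) powi n) \<le> C * (norm a / s) powi n" if "norm z = s" for n z
      using C[OF that] that s0
      by (auto simp: norm_mult norm_power_int norm_divide intro!: mult_right_mono)
    have "(\<lambda>n. (norm a / s) powi n) summable_on {0..}"
      using rs s0 \<open>0 < r\<close>
      by (intro has_sum_imp_summable[OF has_sum_geometric_int_nonneg]) (simp add: divide_less_eq_1)
    then show "(\<lambda>n. C * (norm a / s) powi n) summable_on {0..}"
      by (rule summable_on_cmult_right)
    show "((\<lambda>n. f z * (a / z) powi n) has_sum f z * (z / (z - a))) {0..}" if "norm z = s" for z
    proof -
      have z: "norm (a / z) < 1" "z \<noteq> 0" "z \<noteq> a" using that rs by (auto simp: norm_divide divide_simps)
      then have "1 / (1 - a / z) = z / (z - a)" by (simp add: field_simps)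
      with has_sum_cmult_right[OF has_sum_geometric_int_nonneg[OF z(1)], of "f z"] show ?thesis by simp
    qed
  qed (use s0 cont_term in auto)
  moreover have "((\<lambda>n. circle_mean r (\<lambda>z. f z * (a / z) powi n)) has_sum circle_mean r (\<lambda>z. - (f z * (z / (z - a))))) {..<0}"
  proof (rule has_sum_circle_mean[where M = "\<lambda>n. C' * (norm a / r) powi n"])
    show "norm (f z * (a / z) powi n) \<le> C' * (norm a / r) powi n" if "norm z = r" for n z
      using C'[OF that] that r0
      by (auto simp: norm_mult norm_power_int norm_divide intro!: mult_right_mono)
    have "(\<lambda>n. (norm a / r) powi n) summable_on {..<0}"
      using rs \<open>0 < r\<close>
      by (intro has_sum_imp_summable[OF has_sum_geometric_int_neg]) simp
    then show "(\<lambda>n. C' * (norm a / r) powi n) summable_on {..<0}"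
      by (rule summable_on_cmult_right)
    show "((\<lambda>n. f z * (a / z) powi n) has_sum - (f z * (z / (z - a)))) {..<0}" if "norm z = r" for z
    proof -
      have z: "norm (a / z) > 1" "z \<noteq> 0" "z \<noteq> a"
        using that rs \<open>0 < r\<close> by (auto simp: norm_divide divide_simps)
      then have "1 / (a / z - 1) = - (z / (z - a))" by (simp add: field_simps)
      with has_sum_cmult_right[OF has_sum_geometric_int_neg[OF z(1)], of "f z"] show ?thesis by simp
    qed
  qed (use r0 cont_term in auto)
  moreover have "circle_mean u (\<lambda>z. f z * (a / z) powi n) =
      circle_mean s (\<lambda>z. f z * z powi (-n)) * a powi n" if "u = r \<or> u = s" for u n
    using that coeff[of n] by (auto simp: term_eq[symmetric] circle_mean_cmult)
  ultimately have
    "((\<lambda>n. circle_mean s (\<lambda>z. f z * z powi (-n)) * a powi n) has_sum circle_mean s (\<lambda>z. f z * (z / (z - a)))) {0..}"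
    "((\<lambda>n. circle_mean s (\<lambda>z. f z * z powi (-n)) * a powi n) has_sum circle_mean r (\<lambda>z. - (f z * (z / (z - a))))) {..<0}"
    by simp_all
  then have "((\<lambda>n. circle_mean s (\<lambda>z. f z * z powi (-n)) * a powi n) has_sum
     (circle_mean s (\<lambda>z. f z * (z / (z - a))) + circle_mean r (\<lambda>z. - (f z * (z / (z - a)))))) ({0..} \<union> {..<0})"
    by (rule has_sum_Un_disjoint) auto
  also have "circle_mean r (\<lambda>z. - (f z * (z / (z - a)))) = - circle_mean r (\<lambda>z. f z * (z / (z - a)))"
    using circle_mean_cmult[of r "-1"] by simp
  finally show ?thesis
    using Cauchy_formula_ring[OF assms] by (simp add: int_eq_nonneg_Un_neg[symmetric])
qed

section \<open>Absolutely convergent Laurent series\<close>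

text \<open>
  Bounds one Laurent monomial on a whole ring by its values at the two radii, whatever the sign of
  the exponent. Absolute convergence at the two radii thus gives uniform convergence between them.
\<close>

lemma power_int_le_add_endpoints:
  fixes r x s :: real
  assumes "0 < r" "r \<le> x" "x \<le> s"
  shows "x powi n \<le> r powi n + s powi n"
proof (cases "n \<ge> 0")
  case True
  then have "x powi n \<le> s powi n" using assms by (intro power_int_mono) auto
  moreover have "0 \<le> r powi n" using assms by simp
  ultimately show ?thesis by simp
next
  case False
  then have "x powi n \<le> r powi n" using assms by (intro power_int_antimono) auto
  moreover have "0 \<le> s powi n" using assms by simp
  ultimately show ?thesis by simp
qed

definition laurent_series :: "(int \<Rightarrow> complex) \<Rightarrow> complex \<Rightarrow> complex" where
  "laurent_series b x = (\<Sum>\<^sub>\<infinity>n. b n * x powi n)"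

locale convergent_laurent =
  fixes b :: "int \<Rightarrow> complex" and r s :: real
  assumes r_pos: "0 < r"
    and summable_inner: "(\<lambda>n. norm (b n) * r powi n) summable_on UNIV"
    and summable_outer: "(\<lambda>n. norm (b n) * s powi n) summable_on UNIV"
begin

lemma norm_laurent_term_le:
  assumes "x \<in> closed_ring r s"
  shows "norm (b n * x powi n) \<le> norm (b n) * r powi n + norm (b n) * s powi n"
  using assms power_int_le_add_endpoints[of r "norm x" s n] r_pos
    mult_left_mono[of "norm x powi n" "r powi n + s powi n" "norm (b n)"]
  by (simp add: norm_mult norm_power_int closed_ring_def distrib_left)

lemma summable_laurent_majorant:
  "(\<lambda>n. norm (b n) * r powi n + norm (b n) * s powi n) summable_on UNIV"
  by (intro summable_on_add summable_inner summable_outer)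

lemma uniform_limit_laurent:
  "uniform_limit (closed_ring r s) (\<lambda>X x. \<Sum>n\<in>X. b n * x powi n) (laurent_series b)
     (finite_subsets_at_top UNIV)"
  unfolding laurent_series_def
  by (rule Weierstrass_m_test_general[OF norm_laurent_term_le summable_laurent_majorant])

lemma abs_summable_laurent:
  assumes "x \<in> closed_ring r s"
  shows "(\<lambda>n. norm (b n * x powi n)) summable_on UNIV"
  by (rule Infinite_Sum.abs_summable_on_comparison_test'
      [OF summable_laurent_majorant norm_laurent_term_le[OF assms]])

lemma has_sum_laurent:
  assumes "x \<in> closed_ring r s"
  shows "((\<lambda>n. b n * x powi n) has_sum laurent_series b x) UNIV"
  unfolding laurent_series_def
  by (rule has_sum_infsum[OF abs_summable_summable[OF abs_summable_laurent[OF assms]]])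

lemma continuous_on_laurent: "continuous_on (closed_ring r s) (laurent_series b)"
proof (rule uniform_limit_theorem[OF _ uniform_limit_laurent])
  show "\<forall>\<^sub>F X in finite_subsets_at_top UNIV. continuous_on (closed_ring r s) (\<lambda>x. \<Sum>n\<in>X. b n * x powi n)"
    using r_pos by (intro always_eventually allI continuous_intros) (auto simp: closed_ring_def)
qed auto

lemma holomorphic_on_laurent: "laurent_series b holomorphic_on open_ring r s"
proof -
  have "laurent_series b analytic_on open_ring r s"
    unfolding analytic_on_def
  proof
    fix x assume "x \<in> open_ring r s"
    then obtain e where e: "e > 0" "cball x e \<subseteq> open_ring r s"
      using open_open_ring open_contains_cball by blast
    have sub: "cball x e \<subseteq> closed_ring r s"
      using e(2) by (auto simp: open_ring_def closed_ring_def)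
    have nz: "z \<noteq> 0" if "z \<in> cball x e" for z
      using subsetD[OF sub that] r_pos by (auto simp: closed_ring_def)
    have "\<forall>\<^sub>F X in finite_subsets_at_top UNIV.
        continuous_on (cball x e) (\<lambda>x. \<Sum>n\<in>X. b n * x powi n) \<and>
        (\<lambda>x. \<Sum>n\<in>X. b n * x powi n) holomorphic_on ball x e"
      using nz ball_subset_cball[of x e]
      by (intro always_eventually allI conjI continuous_intros holomorphic_intros) auto
    then show "\<exists>e>0. laurent_series b holomorphic_on ball x e"
      using holomorphic_uniform_limit[OF _ uniform_limit_on_subset[OF uniform_limit_laurent sub]]
        e(1) finite_subsets_at_top_neq_bot by blast
  qed
  then show ?thesis by (rule analytic_imp_holomorphic)
qed

end

lemma summable_on_int_geometric_bound:
  fixes c :: "int \<Rightarrow> real"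
  assumes nonneg: "\<And>n. 0 \<le> c n"
    and right: "\<And>n. n \<ge> 0 \<Longrightarrow> c n \<le> C * \<alpha> powi n" and "\<bar>\<alpha>\<bar> < 1"
    and left: "\<And>n. n < 0 \<Longrightarrow> c n \<le> C * \<beta> powi n" and "\<bar>\<beta>\<bar> > 1"
  shows "c summable_on UNIV"
proof -
  have "c summable_on {0..}"
    by (rule summable_on_comparison_test[where f = "\<lambda>n. C * \<alpha> powi n"])
       (use assms in \<open>auto intro!: summable_on_cmult_right has_sum_imp_summable[OF has_sum_geometric_int_nonneg]\<close>)
  moreover have "c summable_on {..<0}"
    by (rule summable_on_comparison_test[where f = "\<lambda>n. C * \<beta> powi n"])
       (use assms in \<open>auto intro!: summable_on_cmult_right has_sum_imp_summable[OF has_sum_geometric_int_neg]\<close>)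
  ultimately show ?thesis
    unfolding int_eq_nonneg_Un_neg by (rule summable_on_Un_disjoint) auto
qed

section \<open>The Szego series and its continuation across the unit circle\<close>

definition szego_coeff :: "real \<Rightarrow> int \<Rightarrow> real" where
  "szego_coeff \<rho> n = 1 / (1 + \<rho> powi (2 * n + 1))"

definition szego_series :: "real \<Rightarrow> complex \<Rightarrow> complex" where
  "szego_series \<rho> = laurent_series (\<lambda>n. of_real (szego_coeff \<rho> n))"

text \<open>
  The coefficients left after removing the geometric series \<open>\<Sum>n\<ge>0. x ^ n\<close>. They decay
  geometrically in both directions beyond the unit circle, so what remains of the Szego series once
  its pole at 1 is split off lives on a larger ring.
\<close>

definition szego_regular_coeff :: "real \<Rightarrow> int \<Rightarrow> real" where
  "szego_regular_coeff \<rho> n = szego_coeff \<rho> n - (if n \<ge> 0 then 1 else 0)"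

definition szego_regular_part :: "real \<Rightarrow> complex \<Rightarrow> complex" where
  "szego_regular_part \<rho> = laurent_series (\<lambda>n. of_real (szego_regular_coeff \<rho> n))"

context
  fixes \<rho> :: real
  assumes \<rho>: "0 < \<rho>" "\<rho> < 1"
begin

lemma szego_coeff_pos: "szego_coeff \<rho> n > 0"
  using \<rho> by (simp add: szego_coeff_def add_pos_pos)

lemma szego_coeff_le_1: "szego_coeff \<rho> n \<le> 1"
  using \<rho> by (simp add: szego_coeff_def divide_le_eq_1 add_pos_pos)

lemma rho_powi_odd: "\<rho> powi (2 * n + 1) = \<rho> * (\<rho>\<^sup>2) powi n"
  using \<rho> by (simp add: power_int_add power_int_mult)

text \<open>
  The arithmetic core of both halves of the proof: the weights of the two boundary circles add up to
  1, and the Szego series has a functional equation.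
\<close>

lemma szego_coeff_complement: "1 - szego_coeff \<rho> n = \<rho> powi (2 * n + 1) * szego_coeff \<rho> n"
proof -
  have "1 + \<rho> powi (2 * n + 1) \<noteq> 0" using \<rho> by (metis add_pos_pos less_irrefl zero_less_one zero_less_power_int)
  then show ?thesis by (simp add: szego_coeff_def field_simps)
qed

lemma szego_coeff_le: "szego_coeff \<rho> n \<le> 1 / \<rho> * (1 / \<rho>\<^sup>2) powi n"
proof -
  have pos: "\<rho> powi (2 * n + 1) > 0" using \<rho> by simp
  have "szego_coeff \<rho> n \<le> 1 / \<rho> powi (2 * n + 1)"
    unfolding szego_coeff_def using pos by (intro divide_left_mono) auto
  then show ?thesis
    by (simp add: rho_powi_odd power_int_divide_distrib)
qed

lemma convergent_laurent_szego:
  assumes "\<rho>\<^sup>2 < r" "r < 1" "\<rho>\<^sup>2 < s" "s < 1"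
  shows "convergent_laurent (\<lambda>n. of_real (szego_coeff \<rho> n)) r s"
proof -
  have sm: "(\<lambda>n. norm (complex_of_real (szego_coeff \<rho> n)) * t powi n) summable_on UNIV"
    if t: "\<rho>\<^sup>2 < t" "t < 1" for t
  proof -
    have t0: "t > 0" using t(1) zero_le_power2[of \<rho>] by linarith
    show ?thesis
    proof (rule summable_on_int_geometric_bound[where C = "1 / \<rho>" and \<alpha> = t and \<beta> = "t / \<rho>\<^sup>2"])
      fix n :: int
      show "0 \<le> norm (complex_of_real (szego_coeff \<rho> n)) * t powi n" using t0 by simp
      have "szego_coeff \<rho> n \<le> 1 / \<rho>"
      proof -
        have "1 \<le> 1 / \<rho>" using \<rho> by simp
        then show ?thesis using szego_coeff_le_1[of n] by linarith
      qed
      then show "norm (complex_of_real (szego_coeff \<rho> n)) * t powi n \<le> 1 / \<rho> * t powi n"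
        using szego_coeff_pos[of n] t0 by (intro mult_right_mono) auto
      have "szego_coeff \<rho> n * t powi n \<le> (1 / \<rho> * (1 / \<rho>\<^sup>2) powi n) * t powi n"
        using szego_coeff_le[of n] t0 by (intro mult_right_mono) auto
      then show "norm (complex_of_real (szego_coeff \<rho> n)) * t powi n \<le> 1 / \<rho> * (t / \<rho>\<^sup>2) powi n"
        using szego_coeff_pos[of n] by (simp add: power_int_divide_distrib)
    qed (use t t0 \<rho> in auto)
  qed
  show ?thesis
  proof
    show "0 < r" using assms(1) zero_le_power2[of \<rho>] by linarith
  qed (rule sm[OF assms(1,2)], rule sm[OF assms(3,4)])
qed

lemma convergent_laurent_szego_regular:
  assumes "\<rho>\<^sup>2 < r" "r < 1 / \<rho>\<^sup>2" "\<rho>\<^sup>2 < s" "s < 1 / \<rho>\<^sup>2"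
  shows "convergent_laurent (\<lambda>n. of_real (szego_regular_coeff \<rho> n)) r s"
proof -
  have sm: "(\<lambda>n. norm (complex_of_real (szego_regular_coeff \<rho> n)) * t powi n) summable_on UNIV"
    if t: "\<rho>\<^sup>2 < t" "t < 1 / \<rho>\<^sup>2" for t
  proof -
    have t0: "t > 0" using t(1) zero_le_power2[of \<rho>] by linarith
    show ?thesis
    proof (rule summable_on_int_geometric_bound[where C = "1 / \<rho>" and \<alpha> = "\<rho>\<^sup>2 * t" and \<beta> = "t / \<rho>\<^sup>2"])
      fix n :: int
      show "0 \<le> norm (complex_of_real (szego_regular_coeff \<rho> n)) * t powi n" using t0 by simp
      show "norm (complex_of_real (szego_regular_coeff \<rho> n)) * t powi n \<le> 1 / \<rho> * (\<rho>\<^sup>2 * t) powi n"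
        if "n \<ge> 0"
      proof -
        have "\<bar>szego_regular_coeff \<rho> n\<bar> = \<rho> powi (2 * n + 1) * szego_coeff \<rho> n"
          using that szego_coeff_complement[of n] szego_coeff_le_1[of n] by (simp add: szego_regular_coeff_def)
        also have "\<dots> \<le> \<rho> powi (2 * n + 1) * 1"
          using szego_coeff_le_1[of n] \<rho> by (intro mult_left_mono) auto
        also have "\<dots> = \<rho> * (\<rho>\<^sup>2) powi n" by (simp add: rho_powi_odd)
        also have "\<dots> \<le> 1 / \<rho> * (\<rho>\<^sup>2) powi n"
        proof (intro mult_right_mono)
          have "\<rho> \<le> 1" "1 \<le> 1 / \<rho>" using \<rho> by simp_all
          then show "\<rho> \<le> 1 / \<rho>" by linarith
        qed (use \<rho> in simp)
        finally have "\<bar>szego_regular_coeff \<rho> n\<bar> * t powi n \<le> (1 / \<rho> * (\<rho>\<^sup>2) powi n) * t powi n"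
          using t0 by (intro mult_right_mono) auto
        then show ?thesis by (simp add: power_int_mult_distrib)
      qed
      show "norm (complex_of_real (szego_regular_coeff \<rho> n)) * t powi n \<le> 1 / \<rho> * (t / \<rho>\<^sup>2) powi n"
        if "n < 0"
      proof -
        have "szego_coeff \<rho> n * t powi n \<le> (1 / \<rho> * (1 / \<rho>\<^sup>2) powi n) * t powi n"
          using szego_coeff_le[of n] t0 by (intro mult_right_mono) auto
        then show ?thesis
          using szego_coeff_pos[of n] that by (simp add: power_int_divide_distrib szego_regular_coeff_def)
      qed
    next
      have p: "\<rho>\<^sup>2 > 0" using \<rho> by simp
      have "t * \<rho>\<^sup>2 < 1" using t(2) p by (simp only: pos_less_divide_eq)
      moreover have "0 < \<rho>\<^sup>2 * t" using p t0 by simp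
      ultimately show "\<bar>\<rho>\<^sup>2 * t\<bar> < 1" by (simp add: mult.commute)
      have "1 < t / \<rho>\<^sup>2" using t(1) p by (simp only: pos_less_divide_eq mult_1)
      then show "1 < \<bar>t / \<rho>\<^sup>2\<bar>" by linarith
    qed
  qed
  show ?thesis
  proof
    show "0 < r" using assms(1) zero_le_power2[of \<rho>] by linarith
  qed (rule sm[OF assms(1,2)], rule sm[OF assms(3,4)])
qed

lemma has_sum_szego_series:
  assumes "\<rho>\<^sup>2 < norm x" "norm x < 1"
  shows "((\<lambda>n. of_real (szego_coeff \<rho> n) * x powi n) has_sum szego_series \<rho> x) UNIV"
proof -
  have "x \<in> closed_ring (norm x) (norm x)" unfolding closed_ring_def mem_Collect_eq by simp
  with convergent_laurent_szego[OF assms assms] show ?thesis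
    unfolding szego_series_def by (rule convergent_laurent.has_sum_laurent)
qed

lemma has_sum_szego_regular_part:
  assumes "\<rho>\<^sup>2 < norm x" "norm x < 1 / \<rho>\<^sup>2"
  shows "((\<lambda>n. of_real (szego_regular_coeff \<rho> n) * x powi n) has_sum szego_regular_part \<rho> x) UNIV"
proof -
  have "x \<in> closed_ring (norm x) (norm x)" unfolding closed_ring_def mem_Collect_eq by simp
  with convergent_laurent_szego_regular[OF assms assms] show ?thesis
    unfolding szego_regular_part_def by (rule convergent_laurent.has_sum_laurent)
qed

lemma holomorphic_on_szego_regular_part:
  "szego_regular_part \<rho> holomorphic_on open_ring (\<rho>\<^sup>2) (1 / \<rho>\<^sup>2)"
proof -
  have "szego_regular_part \<rho> analytic_on open_ring (\<rho>\<^sup>2) (1 / \<rho>\<^sup>2)"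
    unfolding analytic_on_def
  proof
    fix x assume x: "x \<in> open_ring (\<rho>\<^sup>2) (1 / \<rho>\<^sup>2)"
    define r where "r = (\<rho>\<^sup>2 + norm x) / 2"
    define s where "s = (norm x + 1 / \<rho>\<^sup>2) / 2"
    have rs: "\<rho>\<^sup>2 < r" "r < norm x" "norm x < s" "s < 1 / \<rho>\<^sup>2"
      using x by (simp_all add: open_ring_def r_def s_def)
    then have "szego_regular_part \<rho> holomorphic_on open_ring r s"
      unfolding szego_regular_part_def
      by (intro convergent_laurent.holomorphic_on_laurent convergent_laurent_szego_regular) auto
    moreover have "x \<in> open_ring r s" using rs by (simp add: open_ring_def)
    ultimately show "\<exists>e>0. szego_regular_part \<rho> holomorphic_on ball x e"
      using open_open_ring open_contains_ball holomorphic_on_subset by meson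
  qed
  then show ?thesis by (rule analytic_imp_holomorphic)
qed

lemma rho_sq: "0 < \<rho>\<^sup>2" "\<rho>\<^sup>2 < 1" "1 < 1 / \<rho>\<^sup>2"
proof -
  show "0 < \<rho>\<^sup>2" "\<rho>\<^sup>2 < 1" using \<rho> by (auto simp: power_less_one_iff)
  then show "1 < 1 / \<rho>\<^sup>2" by simp
qed

lemma szego_series_eq_polar_plus_regular:
  assumes "\<rho>\<^sup>2 < norm x" "norm x < 1"
  shows "szego_series \<rho> x = 1 / (1 - x) + szego_regular_part \<rho> x"
proof (rule has_sum_unique[OF has_sum_szego_series[OF assms]])
  have "((\<lambda>n. (if n \<ge> 0 then 1 else 0) * x powi n) has_sum (1 / (1 - x))) UNIV"
    using has_sum_geometric_int_nonneg[OF assms(2)]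
    by (rule has_sum_cong_neutral[THEN iffD1, rotated -1]) auto
  moreover have "((\<lambda>n. of_real (szego_regular_coeff \<rho> n) * x powi n) has_sum szego_regular_part \<rho> x) UNIV"
    by (rule has_sum_szego_regular_part[OF assms(1) less_trans[OF assms(2) rho_sq(3)]])
  ultimately have "((\<lambda>n. (if n \<ge> 0 then 1 else 0) * x powi n + of_real (szego_regular_coeff \<rho> n) * x powi n)
      has_sum (1 / (1 - x) + szego_regular_part \<rho> x)) UNIV"
    by (rule has_sum_add)
  also have "(\<lambda>n. (if n \<ge> 0 then 1 else 0) * x powi n + of_real (szego_regular_coeff \<rho> n) * x powi n) =
      (\<lambda>n. of_real (szego_coeff \<rho> n) * x powi n)"
    by (auto simp: fun_eq_iff szego_regular_coeff_def algebra_simps)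
  finally show "((\<lambda>n. of_real (szego_coeff \<rho> n) * x powi n) has_sum (1 / (1 - x) + szego_regular_part \<rho> x)) UNIV" .
qed

text \<open>
  The functional equation of the continued series. Multiplying by \<open>\<rho>\<close> and scaling \<open>x\<close> by \<open>\<rho>\<^sup>2\<close>
  replaces the coefficient \<open>c\<close> by \<open>1 - c\<close>, so the scaled series and the regular part add up to the
  geometric series over \<open>n < 0\<close>.
\<close>

lemma szego_series_scaled:
  assumes "1 < norm x" "norm x < 1 / \<rho>\<^sup>2"
  shows "of_real \<rho> * szego_series \<rho> (of_real (\<rho>\<^sup>2) * x) = - (1 / (1 - x) + szego_regular_part \<rho> x)"
proof (rule has_sum_unique)
  have "norm (of_real (\<rho>\<^sup>2) * x) < 1" "\<rho>\<^sup>2 < norm (of_real (\<rho>\<^sup>2) * x)"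
    using assms \<rho> by (simp_all add: norm_mult norm_power field_simps)
  from has_sum_cmult_right[OF has_sum_szego_series[OF this(2,1)], of "of_real \<rho>"]
  show "((\<lambda>n. of_real \<rho> * (of_real (szego_coeff \<rho> n) * (of_real (\<rho>\<^sup>2) * x) powi n)) has_sum
     of_real \<rho> * szego_series \<rho> (of_real (\<rho>\<^sup>2) * x)) UNIV" .
  have "((\<lambda>n. (if n < 0 then 1 else 0) * x powi n) has_sum (1 / (x - 1))) UNIV"
    using has_sum_geometric_int_neg[OF assms(1)]
    by (rule has_sum_cong_neutral[THEN iffD1, rotated -1]) auto
  moreover have "((\<lambda>n. of_real (szego_regular_coeff \<rho> n) * x powi n) has_sum szego_regular_part \<rho> x) UNIV"
    using assms rho_sq by (intro has_sum_szego_regular_part) auto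
  ultimately have "((\<lambda>n. (if n < 0 then 1 else 0) * x powi n + - (of_real (szego_regular_coeff \<rho> n) * x powi n)) has_sum
      (1 / (x - 1) + - szego_regular_part \<rho> x)) UNIV"
    by (intro has_sum_add has_sum_uminusI)
  also have "1 / (x - 1) + - szego_regular_part \<rho> x = - (1 / (1 - x) + szego_regular_part \<rho> x)"
    by (simp add: minus_divide_right)
  also have "(\<lambda>n. (if n < 0 then 1 else 0) * x powi n + - (of_real (szego_regular_coeff \<rho> n) * x powi n)) =
      (\<lambda>n. of_real \<rho> * (of_real (szego_coeff \<rho> n) * (of_real (\<rho>\<^sup>2) * x) powi n))"
  proof
    fix n
    have "of_real \<rho> * (of_real (szego_coeff \<rho> n) * (of_real (\<rho>\<^sup>2) * x) powi n) =
      of_real (\<rho> * (\<rho>\<^sup>2) powi n * szego_coeff \<rho> n) * x powi n"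
      by (simp add: power_int_mult_distrib flip: of_real_power)
    also have "\<rho> * (\<rho>\<^sup>2) powi n * szego_coeff \<rho> n = 1 - szego_coeff \<rho> n"
      by (simp add: szego_coeff_complement rho_powi_odd)
    finally show "(if n < 0 then 1 else 0) * x powi n + - (of_real (szego_regular_coeff \<rho> n) * x powi n) =
      of_real \<rho> * (of_real (szego_coeff \<rho> n) * (of_real (\<rho>\<^sup>2) * x) powi n)"
      by (simp add: szego_regular_coeff_def algebra_simps)
  qed
  finally show "((\<lambda>n. of_real \<rho> * (of_real (szego_coeff \<rho> n) * (of_real (\<rho>\<^sup>2) * x) powi n)) has_sum
    - (1 / (1 - x) + szego_regular_part \<rho> x)) UNIV" .
qed

end

section \<open>Infinite q-shifted factorials and theta products\<close>

definition qpoch_inf :: "real \<Rightarrow> complex \<Rightarrow> complex" where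
  "qpoch_inf q x = (\<Prod>n. 1 - x * of_real q ^ n)"

text \<open>
  By Jacobi's triple product this is, up to a constant factor, the theta series
  \<open>\<Sum>\<^sub>\<infinity>n. (- x) powi n * q powi (n * (n - 1) div 2)\<close>; its zeros are the integral powers of \<open>q\<close>.
\<close>

definition theta :: "real \<Rightarrow> complex \<Rightarrow> complex" where
  "theta q x = qpoch_inf q x * qpoch_inf q (of_real q / x)"

context
  fixes q :: real
  assumes q: "0 < q" "q < 1"
begin

lemma has_prod_qpoch_inf: "(\<lambda>n. 1 - x * of_real q ^ n) has_prod qpoch_inf q x"
proof -
  have "summable (\<lambda>n. norm x * q ^ n)"
    using q by (intro summable_mult summable_geometric) auto
  then have "summable (\<lambda>n. norm ((1 - x * of_real q ^ n) - 1))"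
    using q by (simp add: norm_mult norm_power)
  then have "convergent_prod (\<lambda>n. 1 - x * of_real q ^ n)"
    by (intro abs_convergent_prod_imp_convergent_prod summable_imp_abs_convergent_prod)
  then show ?thesis unfolding qpoch_inf_def by (rule convergent_prod_has_prod)
qed

lemma qpoch_inf_step: "qpoch_inf q x = (1 - x) * qpoch_inf q (of_real q * x)"
proof -
  have "convergent_prod (\<lambda>n. 1 - x * of_real q ^ n)"
    using has_prod_qpoch_inf by (auto simp: has_prod_iff)
  from has_prod_ignore_initial_segment'[OF this, of 1]
  have "(\<lambda>n. 1 - x * of_real q ^ n) has_prod ((1 - x) * (\<Prod>n. 1 - of_real q * x * of_real q ^ n))"
    by (simp add: mult_ac)
  then show ?thesis
    using has_prod_unique2[OF has_prod_qpoch_inf] by (simp add: qpoch_inf_def)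
qed

lemma qpoch_inf_eq_0_iff: "qpoch_inf q x = 0 \<longleftrightarrow> (\<exists>n. x * of_real q ^ n = 1)"
  using has_prod_eq_0_iff[OF has_prod_qpoch_inf, of x] by (auto simp: image_iff)

lemma holomorphic_on_qpoch_inf_UNIV: "qpoch_inf q holomorphic_on UNIV"
proof (rule holomorphic_uniform_sequence)
  fix x :: complex
  have "uniformly_convergent_on (cball x 1) (\<lambda>N y. \<Prod>n<N. 1 - y * of_real q ^ n)"
  proof (rule uniformly_convergent_on_prod')
    show "uniformly_convergent_on (cball x 1) (\<lambda>N y. \<Sum>n<N. norm ((1 - y * of_real q ^ n) - 1))"
    proof (rule Weierstrass_m_test')
      show "norm (norm ((1 - y * of_real q ^ n) - 1)) \<le> (norm x + 1) * q ^ n" if "y \<in> cball x 1" for n y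
      proof -
        have "norm y \<le> norm x + 1"
          using that norm_triangle_sub[of y x] by (simp add: dist_norm norm_minus_commute)
        then show ?thesis using q by (simp add: norm_mult norm_power mult_right_mono)
      qed
      show "summable (\<lambda>n. (norm x + 1) * q ^ n)"
        using q by (intro summable_mult summable_geometric) auto
    qed
  qed (auto intro!: continuous_intros)
  then obtain l where l: "uniform_limit (cball x 1) (\<lambda>N y. \<Prod>n<N. 1 - y * of_real q ^ n) l sequentially"
    by (auto simp: uniformly_convergent_on_def)
  have l_eq: "l y = qpoch_inf q y" if "y \<in> cball x 1" for y
    using tendsto_uniform_limitI[OF l that] has_prod_imp_tendsto'[OF has_prod_qpoch_inf[of y]]
      LIMSEQ_unique by blast
  have "uniform_limit (cball x 1) (\<lambda>N y. \<Prod>n<N. 1 - y * of_real q ^ n) (qpoch_inf q) sequentially"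
    by (rule uniform_limit_cong'[THEN iffD1, OF _ _ l]) (auto intro: l_eq)
  then show "\<exists>d>0. cball x d \<subseteq> UNIV \<and>
      uniform_limit (cball x d) (\<lambda>N y. \<Prod>n<N. 1 - y * of_real q ^ n) (qpoch_inf q) sequentially"
    by (intro exI[of _ 1]) auto
qed (auto intro!: holomorphic_intros)

lemma holomorphic_on_qpoch_inf [holomorphic_intros]:
  "f holomorphic_on A \<Longrightarrow> (\<lambda>z. qpoch_inf q (f z)) holomorphic_on A"
  using holomorphic_on_compose_gen[of f A "qpoch_inf q" UNIV] holomorphic_on_qpoch_inf_UNIV
  by (auto simp: o_def)

lemma theta_scale:
  assumes "x \<noteq> 0"
  shows "theta q (of_real q * x) = - theta q x / x"
proof -
  have "qpoch_inf q (1 / x) = (1 - 1 / x) * qpoch_inf q (of_real q / x)"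
    using qpoch_inf_step[of "1 / x"] by simp
  moreover have "of_real q / (of_real q * x) = 1 / x" using q by simp
  ultimately have "theta q (of_real q * x) =
      qpoch_inf q (of_real q * x) * ((1 - 1 / x) * qpoch_inf q (of_real q / x))"
    by (simp add: theta_def)
  also have "\<dots> = - ((1 - x) * qpoch_inf q (of_real q * x) * qpoch_inf q (of_real q / x)) / x"
    using assms by (simp add: field_simps)
  finally show ?thesis
    using qpoch_inf_step[of x] by (simp add: theta_def)
qed

lemma holomorphic_on_theta [holomorphic_intros]:
  assumes "f holomorphic_on A" "\<And>z. z \<in> A \<Longrightarrow> f z \<noteq> 0"
  shows "(\<lambda>z. theta q (f z)) holomorphic_on A"
  unfolding theta_def by (intro holomorphic_intros assms)

end

section \<open>The product formula for the Szego series\<close>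

text \<open>
  On a ring with radii \<open>\<rho>\<^sup>2 * s\<close> and \<open>s\<close> the scaling relation maps the outer circle to the inner
  one. Computing the same Laurent coefficient on both circles gives
  \<open>c (n + 1) = \<rho> powi (2 * n + 1) * c n\<close>, hence \<open>c n = c 0 * \<rho> powi (n\<^sup>2)\<close>: the solutions form a
  line, spanned by a series that is positive at 1.
\<close>

lemma quasi_periodic_determined_at_1:
  fixes \<rho> :: real
  assumes \<rho>: "0 < \<rho>" "\<rho> < 1"
    and holo: "D holomorphic_on open_ring (\<rho>\<^sup>2) (1 / \<rho>\<^sup>2)"
    and scale: "\<And>x. 1 < norm x \<Longrightarrow> norm x < 1 / \<rho>\<^sup>2 \<Longrightarrow>
                  D (of_real (\<rho>\<^sup>2) * x) = D x / (of_real \<rho> * x)"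
    and "D 1 = 0"
    and a: "\<rho>\<^sup>2 < norm a" "norm a < 1"
  shows "D a = 0"
proof -
  have sq: "0 < \<rho>\<^sup>2" "\<rho>\<^sup>2 < 1" using rho_sq[OF \<rho>] by auto
  have gt1: "1 < norm a / \<rho>\<^sup>2" using a sq by simp
  have lt: "norm a / \<rho>\<^sup>2 < 1 / \<rho>\<^sup>2" using a sq by (intro divide_strict_right_mono) auto
  \<comment> \<open>\<open>s > 1\<close> puts the point 1 inside the ring, \<open>\<rho>\<^sup>2 * s < norm a\<close> puts \<open>a\<close> inside\<close>
  from dense[OF gt1] obtain s where s: "1 < s" "s < norm a / \<rho>\<^sup>2" by blast
  then have s_lt: "s < 1 / \<rho>\<^sup>2" using lt by linarith
  define r where "r = \<rho>\<^sup>2 * s"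
  have r: "\<rho>\<^sup>2 < r" "r < norm a" "r < 1" "0 < r"
  proof -
    show "\<rho>\<^sup>2 < r" "0 < r" using s sq by (simp_all add: r_def)
    have "s * \<rho>\<^sup>2 < norm a" using s(2) sq(1) by (simp only: pos_less_divide_eq)
    then show "r < norm a" by (simp add: r_def mult.commute)
    then show "r < 1" using a by linarith
  qed
  have sub: "closed_ring r s \<subseteq> open_ring (\<rho>\<^sup>2) (1 / \<rho>\<^sup>2)" "open_ring r s \<subseteq> closed_ring r s"
    using r s s_lt by (auto simp: closed_ring_def open_ring_def)
  have contD: "continuous_on (closed_ring r s) D" and holD: "D holomorphic_on open_ring r s"
    using holomorphic_on_subset[OF holo] sub holomorphic_on_imp_continuous_on by blast+
  define c where "c n = circle_mean s (\<lambda>z. D z * z powi (-n))" for n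
  have expand: "((\<lambda>n. c n * x powi n) has_sum D x) UNIV" if "x \<in> open_ring r s" for x
    unfolding c_def by (rule Laurent_expansion_ring[OF contD holD r(4) that])
  have rec: "c (n + 1) = of_real (\<rho> powi (2 * n + 1)) * c n" for n
  proof -
    have "c n = circle_mean r (\<lambda>z. D z * z powi (-n))"
      unfolding c_def using r s
      by (intro circle_mean_const_on_ring[symmetric] continuous_intros contD holomorphic_intros holD)
         (auto simp: closed_ring_def open_ring_def)
    also have "\<dots> = circle_mean s (\<lambda>z. D (of_real (\<rho>\<^sup>2) * z) * (of_real (\<rho>\<^sup>2) * z) powi (-n))"
      by (simp add: circle_mean_def r_def mult.assoc)
    also have "\<dots> = circle_mean s (\<lambda>z. of_real (\<rho> powi (- (2 * n + 1))) * (D z * z powi (- (n + 1))))"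
    proof (rule circle_mean_cong)
      fix z :: complex assume z: "norm z = s"
      then have z0: "z \<noteq> 0" using s by auto
      have "D (of_real (\<rho>\<^sup>2) * z) = D z / (of_real \<rho> * z)" using scale z s(1) s_lt by auto
      then have "D (of_real (\<rho>\<^sup>2) * z) * (of_real (\<rho>\<^sup>2) * z) powi (-n) =
        D z * z powi (-n) / z * (of_real ((\<rho>\<^sup>2) powi (-n) / \<rho>))"
        by (simp add: power_int_mult_distrib mult_ac)
      also have "(\<rho>\<^sup>2) powi (-n) / \<rho> = \<rho> powi (- (2 * n + 1))"
        unfolding power_int_minus rho_powi_odd[OF \<rho>] by (simp add: divide_inverse mult.commute)
      also have "D z * z powi (-n) / z = D z * z powi (- (n + 1))"
        unfolding power_int_minus using z0 by (simp add: power_int_add divide_inverse)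
      finally show "D (of_real (\<rho>\<^sup>2) * z) * (of_real (\<rho>\<^sup>2) * z) powi (-n) =
        of_real (\<rho> powi (- (2 * n + 1))) * (D z * z powi (- (n + 1)))" by simp
    qed (use s in auto)
    also have "\<dots> = of_real (\<rho> powi (- (2 * n + 1))) * c (n + 1)"
      by (simp only: circle_mean_cmult c_def)
    finally have "of_real (\<rho> powi (2 * n + 1)) * c n =
        of_real (\<rho> powi (2 * n + 1) * \<rho> powi (- (2 * n + 1))) * c (n + 1)" by simp
    then show ?thesis using \<rho> by (simp flip: power_int_add)
  qed
  have c_eq: "c n = c 0 * of_real (\<rho> powi (n\<^sup>2))" for n
  proof (induction n rule: int_induct[of _ 0])
    case (step1 i)
    then show ?case using rec[of i] \<rho>
      by (simp add: power2_eq_square algebra_simps flip: of_real_mult power_int_add)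
  next
    case (step2 i)
    have "of_real (\<rho> powi (2 * i - 1)) * c (i - 1) = c 0 * of_real (\<rho> powi (i\<^sup>2))"
      using rec[of "i - 1"] step2 by (simp add: algebra_simps)
    moreover have "\<rho> powi (i\<^sup>2) = \<rho> powi (2 * i - 1) * \<rho> powi ((i - 1)\<^sup>2)"
      using \<rho> by (simp add: power2_eq_square algebra_simps flip: power_int_add)
    ultimately show ?case using \<rho> by simp
  qed simp
  have "(c has_sum 0) UNIV"
    using expand[of 1] \<open>D 1 = 0\<close> r s by (simp add: open_ring_def)
  also have "c = (\<lambda>n. c 0 * of_real (\<rho> powi (n\<^sup>2)))"
    using c_eq by (rule ext)
  finally have at_1: "((\<lambda>n. c 0 * of_real (\<rho> powi (n\<^sup>2))) has_sum 0) UNIV" .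
  have "c 0 = 0"
  proof (rule ccontr)
    assume "c 0 \<noteq> 0"
    with at_1 have "((\<lambda>n. complex_of_real (\<rho> powi (n\<^sup>2))) has_sum of_real 0) UNIV"
      by (subst (asm) has_sum_cmult_right_iff) auto
    then have "((\<lambda>n::int. \<rho> powi (n\<^sup>2)) has_sum 0) UNIV"
      by (simp only: has_sum_of_real_iff)
    then have "\<rho> powi ((0::int)\<^sup>2) = 0"
      using \<rho> by (intro nonneg_has_sum_le_0D[where A = UNIV and f = "\<lambda>n. \<rho> powi (n\<^sup>2)"]) auto
    then show False by simp
  qed
  then have "c n = 0" for n using c_eq[of n] by simp
  then have "((\<lambda>n. c n * a powi n) has_sum 0) UNIV" by simp
  moreover have "a \<in> open_ring r s" using r s a by (simp add: open_ring_def)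
  ultimately show ?thesis using expand has_sum_unique by blast
qed

text \<open>
  The series times its theta product and \<open>theta q (- \<rho> * x)\<close> obey the same scaling relation, so they
  are proportional. The constant is read off at \<open>x = 1\<close>, where the pole of the series meets the zero
  of the theta product.
\<close>

theorem szego_series_eq_theta_quotient:
  assumes \<rho>: "0 < \<rho>" "\<rho> < 1" and x: "\<rho>\<^sup>2 < norm x" "norm x < 1"
  shows "szego_series \<rho> x * theta (\<rho>\<^sup>2) x * (qpoch_inf (\<rho>\<^sup>2) (- of_real \<rho>))\<^sup>2 =
         theta (\<rho>\<^sup>2) (- of_real \<rho> * x) * (qpoch_inf (\<rho>\<^sup>2) (of_real (\<rho>\<^sup>2)))\<^sup>2"
proof -
  note sq = rho_sq[OF \<rho>]
  note [holomorphic_intros] = holomorphic_on_qpoch_inf[OF sq(1,2)] holomorphic_on_theta[OF sq(1,2)]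
    holomorphic_on_szego_regular_part[OF \<rho>]
  define q where "q = \<rho>\<^sup>2"
  define N where "N y = theta q (- of_real \<rho> * y)" for y
  \<comment> \<open>\<open>theta q y * (1 / (1 - y) + szego_regular_part \<rho> y)\<close> with the factor \<open>1 - y\<close> cancelled,
    so that it is defined and holomorphic at 1 as well\<close>
  define g where "g y = qpoch_inf q (of_real q * y) * qpoch_inf q (of_real q / y)
      + szego_regular_part \<rho> y * theta q y" for y
  have g_eq: "g y = theta q y * (1 / (1 - y) + szego_regular_part \<rho> y)" if "y \<noteq> 1" for y
  proof -
    have "qpoch_inf q (of_real q * y) = qpoch_inf q y / (1 - y)"
      using qpoch_inf_step[OF sq(1,2), of y] that by (simp add: q_def)
    then show ?thesis by (simp add: g_def theta_def algebra_simps)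
  qed
  define D where "D y = g 1 * N y - N 1 * g y" for y
  have "D x = 0"
  proof (rule quasi_periodic_determined_at_1[OF \<rho> _ _ _ x])
    show "D holomorphic_on open_ring (\<rho>\<^sup>2) (1 / \<rho>\<^sup>2)"
      unfolding D_def N_def g_def q_def
      by (intro holomorphic_intros) (use \<rho> sq in \<open>auto simp: open_ring_def\<close>)
    show "D 1 = 0" by (simp add: D_def)
    fix y :: complex assume y: "1 < norm y" "norm y < 1 / \<rho>\<^sup>2"
    have y0: "y \<noteq> 0" "y \<noteq> 1" using y by auto
    have "N (of_real (\<rho>\<^sup>2) * y) = theta q (of_real q * (- of_real \<rho> * y))"
      by (simp add: N_def q_def mult_ac)
    also have "\<dots> = N y / (of_real \<rho> * y)"
      using theta_scale[OF sq(1,2), of "- of_real \<rho> * y"] y0 \<rho> by (simp add: N_def q_def)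
    finally have N: "N (of_real (\<rho>\<^sup>2) * y) = N y / (of_real \<rho> * y)" .
    have qy: "\<rho>\<^sup>2 < norm (of_real (\<rho>\<^sup>2) * y)" "norm (of_real (\<rho>\<^sup>2) * y) < 1"
      using y sq by (simp_all add: norm_mult norm_power field_simps)
    have cancel: "- T / y * (- X / of_real \<rho>) = T * X / (of_real \<rho> * y)" for T X
      by (simp add: mult_ac)
    have "g (of_real (\<rho>\<^sup>2) * y) = theta q (of_real (\<rho>\<^sup>2) * y) * szego_series \<rho> (of_real (\<rho>\<^sup>2) * y)"
      using qy szego_series_eq_polar_plus_regular[OF \<rho> qy] by (subst g_eq) auto
    also have "\<dots> = - theta q y / y * (- (1 / (1 - y) + szego_regular_part \<rho> y) / of_real \<rho>)"
    proof -
      have "szego_series \<rho> (of_real (\<rho>\<^sup>2) * y) = - (1 / (1 - y) + szego_regular_part \<rho> y) / of_real \<rho>"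
        by (subst szego_series_scaled[OF \<rho> y, symmetric]) (use \<rho> in simp)
      then show ?thesis using theta_scale[OF sq(1,2) y0(1)] by (simp only: q_def)
    qed
    also have "\<dots> = g y / (of_real \<rho> * y)"
      unfolding cancel g_eq[OF y0(2)] ..
    finally show "D (of_real (\<rho>\<^sup>2) * y) = D y / (of_real \<rho> * y)"
      unfolding D_def N by (simp add: diff_divide_distrib)
  qed
  moreover have "N 1 = (qpoch_inf q (- of_real \<rho>))\<^sup>2"
    using \<rho> by (simp add: N_def theta_def q_def power2_eq_square)
  moreover have "qpoch_inf q 1 = 0"
    using qpoch_inf_step[OF sq(1,2), of 1] by (simp add: q_def)
  then have "g 1 = (qpoch_inf q (of_real q))\<^sup>2"
    by (simp add: g_def theta_def power2_eq_square)
  moreover have "g x = theta q x * szego_series \<rho> x"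
    using x szego_series_eq_polar_plus_regular[OF \<rho> x] by (subst g_eq) auto
  ultimately show ?thesis by (simp add: D_def N_def q_def algebra_simps)
qed

section \<open>The reproducing kernel of the Hardy space\<close>

definition szego_candidate :: "real \<Rightarrow> complex \<Rightarrow> complex \<Rightarrow> complex" where
  "szego_candidate \<rho> a z = szego_series \<rho> (cnj a * z) / (2 * of_real pi)"

lemma integral_circle_eq_circle_mean:
  assumes "continuous_on (sphere 0 r) f" "r \<ge> 0"
  shows "(LINT t | lebesgue_on {0..2*pi}. f (of_real r * cis t)) = 2 * of_real pi * circle_mean r f"
  by (subst lebesgue_integral_eq_integral)
     (auto simp: circle_mean_def intro!: continuous_imp_integrable_real continuous_on_circle assms)

lemma arc_integral_eq_circle_means:
  assumes "continuous_on (sphere 0 1) f" "continuous_on (sphere 0 \<rho>) f" "\<rho> \<ge> 0"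
  shows "arc_integral \<rho> f = 2 * of_real pi * (circle_mean 1 f + of_real \<rho> * circle_mean \<rho> f)"
  using integral_circle_eq_circle_mean[OF assms(1)] integral_circle_eq_circle_mean[OF assms(2,3)]
  by (simp add: arc_integral_def scaleR_conv_of_real algebra_simps)

text \<open>
  The Cauchy-Schwarz inequality against the constant 1, obtained from the nonnegativity of the
  variance of \<open>u\<close>.
\<close>

lemma L1_le_L2_on_interval:
  fixes u :: "real \<Rightarrow> real"
  assumes u: "u \<in> borel_measurable (lebesgue_on {0..2*pi})"
    and u2: "integrable (lebesgue_on {0..2*pi}) (\<lambda>t. (u t)\<^sup>2)"
  shows "integrable (lebesgue_on {0..2*pi}) u"
    and "(LINT t | lebesgue_on {0..2*pi}. u t)\<^sup>2 \<le> 2 * pi * (LINT t | lebesgue_on {0..2*pi}. (u t)\<^sup>2)"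
proof -
  let ?M = "lebesgue_on {0..2*pi}"
  interpret finite_measure ?M by (rule finite_measure_lebesgue_on) simp
  show int: "integrable ?M u" by (rule square_integrable_imp_integrable[OF u u2])
  have vol: "measure ?M {0..2*pi} = 2 * pi"
    by (simp add: measure_restrict_space)
  define m where "m = (LINT t | ?M. u t) / (2 * pi)"
  have "0 \<le> (LINT t | ?M. (u t - m)\<^sup>2)" by (rule integral_nonneg_AE) auto
  also have "(LINT t | ?M. (u t - m)\<^sup>2) = (LINT t | ?M. (u t)\<^sup>2 - 2 * m * u t + m\<^sup>2)"
    by (rule Bochner_Integration.integral_cong) (auto simp: power2_diff)
  also have "\<dots> = (LINT t | ?M. (u t)\<^sup>2) - 2 * m * (LINT t | ?M. u t) + m\<^sup>2 * (2 * pi)"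
    using int u2 by (simp add: vol)
  also have "\<dots> = (LINT t | ?M. (u t)\<^sup>2) - (LINT t | ?M. u t)\<^sup>2 / (2 * pi)"
    by (simp add: m_def power2_eq_square field_simps)
  finally show "(LINT t | ?M. u t)\<^sup>2 \<le> 2 * pi * (LINT t | ?M. (u t)\<^sup>2)"
    by (simp add: field_simps)
qed

lemma annulus_eq_open_ring: "annulus \<rho> = open_ring \<rho> 1"
  by (simp add: annulus_def open_ring_def)

context
  fixes \<rho> :: real
  assumes \<rho>: "0 < \<rho>" "\<rho> < 1"
begin

lemma closed_annulus_eq_closed_ring: "annulus \<rho> \<union> annulus_boundary \<rho> = closed_ring \<rho> 1"
  using \<rho> by (auto simp: annulus_def annulus_boundary_def closed_ring_def)

lemma spheres_subset_closed_annulus: "sphere 0 1 \<subseteq> closed_ring \<rho> 1" "sphere 0 \<rho> \<subseteq> closed_ring \<rho> 1"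
  using \<rho> by (auto simp: closed_ring_def)

lemma norm_cnj_mult_bounds:
  assumes a: "a \<in> open_ring \<rho> 1" and z: "z \<in> closed_ring \<rho> 1"
  shows "\<rho>\<^sup>2 < norm (cnj a * z)" "norm (cnj a * z) < 1"
proof -
  have "\<rho> * \<rho> < norm a * \<rho>" using a \<rho> by (simp add: open_ring_def)
  also have "\<dots> \<le> norm a * norm z" using z by (intro mult_left_mono) (auto simp: closed_ring_def)
  finally show "\<rho>\<^sup>2 < norm (cnj a * z)" by (simp add: norm_mult power2_eq_square)
  have "norm a * norm z \<le> norm a * 1" using z by (intro mult_left_mono) (auto simp: closed_ring_def)
  also have "\<dots> < 1" using a by (simp add: open_ring_def)
  finally show "norm (cnj a * z) < 1" by (simp add: norm_mult)
qed

text \<open>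
  The points \<open>cnj a * z\<close> stay in a ring with radii \<open>norm a * \<rho>\<close> and \<open>norm a\<close>, both strictly
  between \<open>\<rho>\<^sup>2\<close> and 1. This gives continuity up to both boundary circles.
\<close>

lemma szego_candidate_regular:
  assumes a: "a \<in> open_ring \<rho> 1"
  shows "continuous_on (closed_ring \<rho> 1) (szego_candidate \<rho> a)"
    and "szego_candidate \<rho> a holomorphic_on open_ring \<rho> 1"
proof -
  have na: "\<rho> < norm a" "norm a < 1" using a by (auto simp: open_ring_def)
  define r where "r = norm a * \<rho>"
  define s where "s = norm a"
  have "\<rho> * \<rho> < r" using na \<rho> by (simp add: r_def)
  moreover have "r < 1" using na \<rho> mult_strict_mono[of "norm a" 1 \<rho> 1] by (simp add: r_def)
  moreover have "\<rho> * \<rho> < s"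
  proof -
    have "\<rho> * \<rho> < \<rho> * 1" using \<rho> by (intro mult_strict_left_mono) auto
    then show ?thesis using na by (simp add: s_def)
  qed
  ultimately interpret convergent_laurent "\<lambda>n. of_real (szego_coeff \<rho> n)" r s
    using na by (intro convergent_laurent_szego[OF \<rho>]) (auto simp: s_def power2_eq_square)
  have "cnj a * z \<in> closed_ring r s" if "z \<in> closed_ring \<rho> 1" for z
    using that na \<rho> by (auto simp: closed_ring_def r_def s_def norm_mult intro!: mult_left_mono mult_left_le)
  then have "continuous_on (closed_ring \<rho> 1) (\<lambda>z. laurent_series (\<lambda>n. of_real (szego_coeff \<rho> n)) (cnj a * z))"
    by (intro continuous_on_compose2[OF continuous_on_laurent] continuous_intros) auto
  then show "continuous_on (closed_ring \<rho> 1) (szego_candidate \<rho> a)"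
    unfolding szego_candidate_def szego_series_def by (intro continuous_intros) auto
  have sub: "cnj a * z \<in> open_ring r s" if "z \<in> open_ring \<rho> 1" for z
  proof -
    have "norm a > 0" using na \<rho> by linarith
    then have "norm a * \<rho> < norm a * norm z" "norm a * norm z < norm a * 1"
      using that by (auto simp: open_ring_def simp del: zero_less_norm_iff intro!: mult_strict_left_mono)
    then show ?thesis by (simp add: open_ring_def r_def s_def norm_mult)
  qed
  have "laurent_series (\<lambda>n. of_real (szego_coeff \<rho> n)) \<circ> (\<lambda>z. cnj a * z) holomorphic_on open_ring \<rho> 1"
    by (rule holomorphic_on_compose_gen[OF _ holomorphic_on_laurent]) (auto intro!: holomorphic_intros sub)
  then show "szego_candidate \<rho> a holomorphic_on open_ring \<rho> 1"
    unfolding szego_candidate_def szego_series_def o_def by (intro holomorphic_intros) auto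
qed

text \<open>
  On the circle of radius \<open>r\<close> one has \<open>cnj z = r\<^sup>2 / z\<close>, so pairing with the conjugate of the
  \<open>n\<close>-th monomial extracts the \<open>n\<close>-th Laurent coefficient of \<open>F\<close>, with the weight
  \<open>r powi (2 * n)\<close>.
\<close>

lemma has_sum_circle_mean_szego:
  assumes cont: "continuous_on (closed_ring \<rho> 1) F" and holo: "F holomorphic_on open_ring \<rho> 1"
    and a: "a \<in> open_ring \<rho> 1" and r: "r = 1 \<or> r = \<rho>"
  shows "((\<lambda>n. of_real (szego_coeff \<rho> n * r powi (2 * n)) *
               (circle_mean 1 (\<lambda>z. F z * z powi (-n)) * a powi n))
          has_sum circle_mean r (\<lambda>z. F z * cnj (szego_series \<rho> (cnj a * z)))) UNIV"
proof -
  have r0: "r > 0" using r \<rho> by auto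
  have sub: "sphere 0 r \<subseteq> closed_ring \<rho> 1" using r spheres_subset_closed_annulus by auto
  have a0: "a \<noteq> 0" using a \<rho> by (auto simp: open_ring_def)
  define g where "g n z = F z * (of_real (szego_coeff \<rho> n) * (a * cnj z) powi n)" for n z
  obtain C where C: "\<And>z. norm z = r \<Longrightarrow> norm (F z) \<le> C"
    using bounded_on_circle[OF continuous_on_subset[OF cont sub]] by blast
  have "((\<lambda>n. circle_mean r (g n)) has_sum circle_mean r (\<lambda>z. F z * cnj (szego_series \<rho> (cnj a * z)))) UNIV"
  proof (rule has_sum_circle_mean[where M = "\<lambda>n. C * (szego_coeff \<rho> n * (norm a * r) powi n)"])
    show "continuous_on (sphere 0 r) (g n)" for n
      unfolding g_def using r0 a0
      by (intro continuous_on_mult continuous_on_power_int continuous_on_cnj continuous_on_const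
          continuous_on_id continuous_on_subset[OF cont sub]) auto
    show "norm (g n z) \<le> C * (szego_coeff \<rho> n * (norm a * r) powi n)" if "norm z = r" for n z
      using C[OF that] that szego_coeff_pos[OF \<rho>, of n] r0
      by (auto simp: g_def norm_mult norm_power_int intro!: mult_right_mono)
    have "of_real r \<in> closed_ring \<rho> 1" using sub r0 by auto
    from norm_cnj_mult_bounds[OF a this]
    have "convergent_laurent (\<lambda>n. of_real (szego_coeff \<rho> n)) (norm a * r) (norm a * r)"
      using r0 by (intro convergent_laurent_szego[OF \<rho>]) (auto simp: norm_mult)
    then show "(\<lambda>n. C * (szego_coeff \<rho> n * (norm a * r) powi n)) summable_on UNIV"
      using szego_coeff_pos[OF \<rho>] less_imp_le
      by (intro summable_on_cmult_right) (auto simp: convergent_laurent_def abs_of_pos)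
    show "((\<lambda>n. g n z) has_sum F z * cnj (szego_series \<rho> (cnj a * z))) UNIV" if "norm z = r" for z
    proof -
      have "z \<in> closed_ring \<rho> 1" using sub that by auto
      then have "((\<lambda>n. of_real (szego_coeff \<rho> n) * (cnj a * z) powi n) has_sum szego_series \<rho> (cnj a * z)) UNIV"
        by (intro has_sum_szego_series[OF \<rho>] norm_cnj_mult_bounds a)
      then have "((\<lambda>n. cnj (of_real (szego_coeff \<rho> n) * (cnj a * z) powi n)) has_sum cnj (szego_series \<rho> (cnj a * z))) UNIV"
        by (simp only: has_sum_cnj_iff)
      then have "((\<lambda>n. F z * cnj (of_real (szego_coeff \<rho> n) * (cnj a * z) powi n)) has_sum
         F z * cnj (szego_series \<rho> (cnj a * z))) UNIV"
        by (rule has_sum_cmult_right)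
      then show ?thesis by (simp add: g_def)
    qed
  qed (use r0 in auto)
  moreover have "circle_mean r (g n) = of_real (szego_coeff \<rho> n * r powi (2 * n)) *
               (circle_mean 1 (\<lambda>z. F z * z powi (-n)) * a powi n)" for n
  proof -
    have "circle_mean r (g n) =
      circle_mean r (\<lambda>z. (of_real (szego_coeff \<rho> n * r powi (2 * n)) * a powi n) * (F z * z powi (-n)))"
    proof (rule circle_mean_cong)
      fix z :: complex assume z: "norm z = r"
      then have z0: "z \<noteq> 0" using r0 by auto
      have "z * cnj z = of_real (r\<^sup>2)" using z by (simp add: complex_norm_square[symmetric])
      then have "cnj z = of_real (r\<^sup>2) / z" using z0 by (simp add: field_simps)
      then have "(a * cnj z) powi n = a powi n * (of_real (r powi (2 * n)) * z powi (-n))"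
        by (simp add: power_int_mult_distrib power_int_divide_distrib power_int_minus power_int_mult
            power_int_inverse divide_inverse)
      then show "g n z = (of_real (szego_coeff \<rho> n * r powi (2 * n)) * a powi n) * (F z * z powi (-n))"
        by (simp add: g_def mult_ac)
    qed (use r0 in auto)
    also have "\<dots> = (of_real (szego_coeff \<rho> n * r powi (2 * n)) * a powi n) * circle_mean r (\<lambda>z. F z * z powi (-n))"
      by (rule circle_mean_cmult)
    also have "circle_mean r (\<lambda>z. F z * z powi (-n)) = circle_mean 1 (\<lambda>z. F z * z powi (-n))"
    proof (cases "r = 1")
      case False
      with r have "r = \<rho>" by simp
      then show ?thesis
        using \<rho> by (simp only:, intro circle_mean_const_on_ring continuous_intros cont holomorphic_intros holo)
                   (auto simp: closed_ring_def open_ring_def)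
    qed simp
    finally show ?thesis by (simp add: mult_ac)
  qed
  ultimately show ?thesis by simp
qed

text \<open>
  The weights \<open>1\<close> and \<open>\<rho> * \<rho> powi (2 * n)\<close> of the two circles cancel the denominator
  \<open>1 + \<rho> powi (2 * n + 1)\<close> of the kernel, and the Laurent series of \<open>F\<close> at \<open>a\<close> remains.
\<close>

lemma szego_candidate_reproduces_continuous:
  assumes cont: "continuous_on (closed_ring \<rho> 1) F" and holo: "F holomorphic_on open_ring \<rho> 1"
    and a: "a \<in> open_ring \<rho> 1"
  shows "boundary_inner \<rho> F (szego_candidate \<rho> a) = F a"
proof -
  define A where "A z = F z * cnj (szego_series \<rho> (cnj a * z))" for z
  define c where "c n = circle_mean 1 (\<lambda>z. F z * z powi (-n)) * a powi n" for n
  have "((\<lambda>n. of_real (szego_coeff \<rho> n * 1 powi (2 * n)) * c n +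
      of_real \<rho> * (of_real (szego_coeff \<rho> n * \<rho> powi (2 * n)) * c n)) has_sum
      circle_mean 1 A + of_real \<rho> * circle_mean \<rho> A) UNIV"
    unfolding A_def c_def
    by (intro has_sum_add has_sum_cmult_right has_sum_circle_mean_szego cont holo a) auto
  also have "(\<lambda>n. of_real (szego_coeff \<rho> n * 1 powi (2 * n)) * c n +
      of_real \<rho> * (of_real (szego_coeff \<rho> n * \<rho> powi (2 * n)) * c n)) = c"
  proof
    fix n
    have "of_real (szego_coeff \<rho> n * 1 powi (2 * n)) * c n +
      of_real \<rho> * (of_real (szego_coeff \<rho> n * \<rho> powi (2 * n)) * c n) =
      of_real (szego_coeff \<rho> n + \<rho> * \<rho> powi (2 * n) * szego_coeff \<rho> n) * c n"
      by (simp add: algebra_simps)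
    also have "\<rho> * \<rho> powi (2 * n) * szego_coeff \<rho> n = 1 - szego_coeff \<rho> n"
      using \<rho> by (simp add: szego_coeff_complement[OF \<rho>] power_int_add)
    finally show "of_real (szego_coeff \<rho> n * 1 powi (2 * n)) * c n +
      of_real \<rho> * (of_real (szego_coeff \<rho> n * \<rho> powi (2 * n)) * c n) = c n" by simp
  qed
  finally have "(c has_sum circle_mean 1 A + of_real \<rho> * circle_mean \<rho> A) UNIV" .
  moreover have "(c has_sum F a) UNIV"
    unfolding c_def by (rule Laurent_expansion_ring[OF cont holo \<rho>(1) a])
  ultimately have FA: "circle_mean 1 A + of_real \<rho> * circle_mean \<rho> A = F a"
    by (rule has_sum_unique)
  have A_eq: "F z * cnj (szego_candidate \<rho> a z) = 1 / (2 * of_real pi) * A z" for z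
    by (simp add: A_def szego_candidate_def)
  have "continuous_on (sphere 0 u) (\<lambda>z. F z * cnj (szego_candidate \<rho> a z))" if "u = 1 \<or> u = \<rho>" for u
    using that spheres_subset_closed_annulus
    by (auto intro!: continuous_intros intro: continuous_on_subset[OF cont]
        continuous_on_subset[OF szego_candidate_regular(1)[OF a]])
  then have "boundary_inner \<rho> F (szego_candidate \<rho> a) =
     2 * of_real pi * (circle_mean 1 (\<lambda>z. F z * cnj (szego_candidate \<rho> a z)) +
        of_real \<rho> * circle_mean \<rho> (\<lambda>z. F z * cnj (szego_candidate \<rho> a z)))"
    unfolding boundary_inner_def using \<rho> by (intro arc_integral_eq_circle_means) auto
  also have "\<dots> = circle_mean 1 A + of_real \<rho> * circle_mean \<rho> A"
    unfolding A_eq circle_mean_cmult by (simp add: algebra_simps add_divide_distrib)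
  finally show ?thesis using FA by simp
qed

lemma continuous_imp_boundary_L2:
  assumes "continuous_on (closed_ring \<rho> 1) F"
  shows "F \<in> boundary_L2 \<rho>"
proof -
  have c: "continuous_on {0..2*pi} (\<lambda>t. F (of_real r * cis t))" if "r \<in> {1, \<rho>}" for r
  proof (rule continuous_on_circle)
    show "continuous_on (sphere 0 r) F"
      by (rule continuous_on_subset[OF assms]) (use that spheres_subset_closed_annulus in auto)
  qed (use that \<rho> in auto)
  show ?thesis
    unfolding boundary_L2_def mem_Collect_eq
    by (intro ballI conjI continuous_imp_measurable_on_sets_lebesgue continuous_imp_integrable_real
        continuous_intros c) auto
qed

lemma continuous_imp_hardy:
  assumes "continuous_on (closed_ring \<rho> 1) F" "F holomorphic_on open_ring \<rho> 1"
  shows "F \<in> hardy_space \<rho>"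
  unfolding hardy_space_def mem_Collect_eq closed_annulus_eq_closed_ring
  unfolding annulus_eq_open_ring
  using assms continuous_imp_boundary_L2[OF assms(1)]
  by (intro conjI exI[of _ "\<lambda>_. F"]) (auto simp: arc_integral_def)

lemma boundary_L2_circle:
  assumes "f \<in> boundary_L2 \<rho>" "r = 1 \<or> r = \<rho>"
  shows "(\<lambda>t. f (of_real r * cis t)) \<in> borel_measurable (lebesgue_on {0..2*pi})"
    and "integrable (lebesgue_on {0..2*pi}) (\<lambda>t. (norm (f (of_real r * cis t)))\<^sup>2)"
  using assms by (auto simp: boundary_L2_def)

text \<open>
  A function \<open>k\<close> continuous on the closed annulus is bounded on the boundary, so the error is at most
  a constant times the \<open>L\<^sup>1\<close> distance, which the \<open>L\<^sup>2\<close> distance controls on a set of finite measure.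
\<close>

lemma boundary_inner_tendsto:
  assumes F: "\<And>n. F n \<in> boundary_L2 \<rho>" and f: "f \<in> boundary_L2 \<rho>"
    and k: "continuous_on (closed_ring \<rho> 1) k"
    and lim: "(\<lambda>n. arc_integral \<rho> (\<lambda>z. (norm (F n z - f z))\<^sup>2)) \<longlonglongrightarrow> 0"
  shows "(\<lambda>n. boundary_inner \<rho> (F n) k) \<longlonglongrightarrow> boundary_inner \<rho> f k"
proof -
  let ?M = "lebesgue_on {0..2*pi}"
  define u where "u r n t = norm (F n (of_real r * cis t) - f (of_real r * cis t))" for r n t
  define L where "L r n = (LINT t | ?M. (u r n t)\<^sup>2)" for r n
  have um: "u r n \<in> borel_measurable ?M" and u2: "integrable ?M (\<lambda>t. (u r n t)\<^sup>2)"
    if "r = 1 \<or> r = \<rho>" for r n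
  proof -
    note [measurable] = boundary_L2_circle(1)[OF F that, of n] boundary_L2_circle(1)[OF f that]
    show "u r n \<in> borel_measurable ?M" unfolding u_def by measurable
    then have [measurable]: "u r n \<in> borel_measurable ?M" .
    show "integrable ?M (\<lambda>t. (u r n t)\<^sup>2)"
    proof (rule Bochner_Integration.integrable_bound)
      show "integrable ?M (\<lambda>t. 2 * (norm (F n (of_real r * cis t)))\<^sup>2 + 2 * (norm (f (of_real r * cis t)))\<^sup>2)"
        using boundary_L2_circle(2)[OF F that, of n] boundary_L2_circle(2)[OF f that] by simp
      show "(\<lambda>t. (u r n t)\<^sup>2) \<in> borel_measurable ?M" by measurable
      have "(norm (x - y))\<^sup>2 \<le> 2 * (norm x)\<^sup>2 + 2 * (norm y)\<^sup>2" for x y :: complex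
      proof -
        have "(norm (x - y))\<^sup>2 \<le> (norm x + norm y)\<^sup>2"
          by (intro power_mono norm_triangle_ineq4) auto
        also have "\<dots> \<le> 2 * (norm x)\<^sup>2 + 2 * (norm y)\<^sup>2"
          using sum_squares_ge_zero[of "norm x - norm y" 0] by (simp add: power2_eq_square algebra_simps)
        finally show ?thesis .
      qed
      then show "AE t in ?M. norm ((u r n t)\<^sup>2) \<le>
          norm (2 * (norm (F n (of_real r * cis t)))\<^sup>2 + 2 * (norm (f (of_real r * cis t)))\<^sup>2)"
        by (simp add: u_def)
    qed
  qed
  have L0: "L r n \<ge> 0" for r n unfolding L_def by (rule integral_nonneg_AE) auto
  have lim': "(\<lambda>n. L 1 n + \<rho> * L \<rho> n) \<longlonglongrightarrow> 0"
    using lim by (simp add: arc_integral_def L_def u_def)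
  have Llim: "L r \<longlonglongrightarrow> 0" if "r = 1 \<or> r = \<rho>" for r
  proof -
    have lim2: "(\<lambda>n. (L 1 n + \<rho> * L \<rho> n) / \<rho>) \<longlonglongrightarrow> 0" using tendsto_divide[OF lim' tendsto_const, of \<rho>] \<rho> by simp
    have up: "L r n \<le> (L 1 n + \<rho> * L \<rho> n) / \<rho>" for n
    proof -
      have "\<rho> * L r n \<le> L 1 n + \<rho> * L \<rho> n"
        using that L0[of 1 n] L0[of \<rho> n] \<rho> mult_right_le_one_le[of "L 1 n" \<rho>]
        by (auto simp: mult.commute add_increasing2)
      then show ?thesis using \<rho> by (simp add: pos_le_divide_eq mult.commute)
    qed
    show ?thesis
      by (rule tendsto_sandwich[OF _ _ tendsto_const lim2]) (simp_all add: L0 up)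
  qed
  have circ: "(\<lambda>n. LINT t | ?M. F n (of_real r * cis t) * cnj (k (of_real r * cis t))) \<longlonglongrightarrow>
      (LINT t | ?M. f (of_real r * cis t) * cnj (k (of_real r * cis t)))" if r: "r = 1 \<or> r = \<rho>" for r
  proof -
    have "sphere 0 r \<subseteq> closed_ring \<rho> 1" using r spheres_subset_closed_annulus by auto
    then have kc: "continuous_on (sphere 0 r) k" by (rule continuous_on_subset[OF k])
    have r0: "r \<ge> 0" using r \<rho> by auto
    obtain C where "\<And>z. norm z = r \<Longrightarrow> norm (k z) \<le> C"
      using bounded_on_circle[OF kc] by blast
    then have C: "norm (k (of_real r * cis t)) \<le> C" for t using r0 by (simp add: norm_mult)
    then have C0: "C \<ge> 0" using norm_ge_zero order_trans by blast
    have km: "(\<lambda>t. k (of_real r * cis t)) \<in> borel_measurable ?M"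
      by (intro continuous_imp_measurable_on_sets_lebesgue continuous_on_circle kc r0) auto
    have int: "integrable ?M (\<lambda>t. h (of_real r * cis t) * cnj (k (of_real r * cis t)))"
      if h: "h \<in> boundary_L2 \<rho>" for h
    proof (rule Bochner_Integration.integrable_bound)
      note [measurable] = boundary_L2_circle(1)[OF h r] km
      have "(\<lambda>t. norm (h (of_real r * cis t))) \<in> borel_measurable ?M" by measurable
      from L1_le_L2_on_interval(1)[OF this boundary_L2_circle(2)[OF h r]]
      show "integrable ?M (\<lambda>t. C * norm (h (of_real r * cis t)))" by simp
      have "(\<lambda>t. cnj (k (of_real r * cis t))) \<in> borel_measurable ?M"
        by (intro continuous_imp_measurable_on_sets_lebesgue continuous_on_cnj continuous_on_circle kc r0) auto
      then show "(\<lambda>t. h (of_real r * cis t) * cnj (k (of_real r * cis t))) \<in> borel_measurable ?M"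
        by measurable
      show "AE t in ?M. norm (h (of_real r * cis t) * cnj (k (of_real r * cis t))) \<le>
          norm (C * norm (h (of_real r * cis t)))"
      proof (rule AE_I2)
        fix t
        show "norm (h (of_real r * cis t) * cnj (k (of_real r * cis t))) \<le>
            norm (C * norm (h (of_real r * cis t)))"
          using mult_right_mono[OF C[of t] norm_ge_zero[of "h (of_real r * cis t)"]] C0
          by (simp add: norm_mult mult.commute)
      qed
    qed
    have bound: "norm ((LINT t | ?M. F n (of_real r * cis t) * cnj (k (of_real r * cis t))) -
      (LINT t | ?M. f (of_real r * cis t) * cnj (k (of_real r * cis t)))) \<le> C * sqrt (2 * pi * L r n)" for n
    proof -
      have "norm ((LINT t | ?M. F n (of_real r * cis t) * cnj (k (of_real r * cis t))) -
        (LINT t | ?M. f (of_real r * cis t) * cnj (k (of_real r * cis t)))) =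
        norm (LINT t | ?M. F n (of_real r * cis t) * cnj (k (of_real r * cis t)) -
                f (of_real r * cis t) * cnj (k (of_real r * cis t)))"
        by (subst Bochner_Integration.integral_diff[OF int[OF F] int[OF f]]) simp
      also have "\<dots> \<le> (LINT t | ?M. C * u r n t)"
      proof (rule Bochner_Integration.integral_norm_bound_integral)
        show "integrable ?M (\<lambda>t. F n (of_real r * cis t) * cnj (k (of_real r * cis t)) -
                f (of_real r * cis t) * cnj (k (of_real r * cis t)))"
          by (rule Bochner_Integration.integrable_diff[OF int[OF F] int[OF f]])
        show "integrable ?M (\<lambda>t. C * u r n t)"
          using L1_le_L2_on_interval(1)[OF um[OF r] u2[OF r], of n] by simp
        show "norm (F n (of_real r * cis t) * cnj (k (of_real r * cis t)) -
                f (of_real r * cis t) * cnj (k (of_real r * cis t))) \<le> C * u r n t" for t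
        proof -
          have "norm ((F n (of_real r * cis t) - f (of_real r * cis t)) * cnj (k (of_real r * cis t))) \<le> u r n t * C"
            unfolding norm_mult u_def using C by (intro mult_left_mono) auto
          then show ?thesis by (simp only: left_diff_distrib mult.commute[of C])
        qed
      qed
      also have "\<dots> = C * (LINT t | ?M. u r n t)" by simp
      also have "\<dots> \<le> C * sqrt (2 * pi * L r n)"
        unfolding L_def using L1_le_L2_on_interval(2)[OF um[OF r] u2[OF r], of n] C0
        by (intro mult_left_mono real_le_rsqrt)
      finally show ?thesis .
    qed
    have "(\<lambda>n. C * sqrt (2 * pi * L r n)) \<longlonglongrightarrow> C * sqrt (2 * pi * 0)"
      by (intro tendsto_intros Llim r)
    then have z: "(\<lambda>n. C * sqrt (2 * pi * L r n)) \<longlonglongrightarrow> 0" by simp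
    show ?thesis
      by (rule LIM_zero_cancel, rule tendsto_norm_zero_cancel,
          rule tendsto_sandwich[OF _ _ tendsto_const[of 0] z]) (simp_all add: bound)
  qed
  show ?thesis
    unfolding boundary_inner_def arc_integral_def
    using circ[of 1] circ[of \<rho>] by (intro tendsto_intros) auto
qed

lemma szego_candidate_represents_evaluation:
  assumes a: "a \<in> open_ring \<rho> 1"
  shows "represents_evaluation \<rho> a (szego_candidate \<rho> a)"
  unfolding represents_evaluation_def
proof (intro conjI ballI)
  show "szego_candidate \<rho> a \<in> hardy_space \<rho>"
    by (intro continuous_imp_hardy szego_candidate_regular a)
  fix f assume "f \<in> hardy_space \<rho>"
  then obtain F where f: "f \<in> boundary_L2 \<rho>"
    and F: "\<And>n. continuous_on (closed_ring \<rho> 1) (F n)" "\<And>n. F n holomorphic_on open_ring \<rho> 1"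
    and lim: "(\<lambda>n. arc_integral \<rho> (\<lambda>z. (norm (F n z - f z))\<^sup>2)) \<longlonglongrightarrow> 0"
    and pw: "\<And>z. z \<in> open_ring \<rho> 1 \<Longrightarrow> (\<lambda>n. F n z) \<longlonglongrightarrow> f z"
    unfolding hardy_space_def mem_Collect_eq closed_annulus_eq_closed_ring
    unfolding annulus_eq_open_ring by blast
  have "(\<lambda>n. boundary_inner \<rho> (F n) (szego_candidate \<rho> a)) \<longlonglongrightarrow> boundary_inner \<rho> f (szego_candidate \<rho> a)"
    by (intro boundary_inner_tendsto continuous_imp_boundary_L2 F f szego_candidate_regular(1) a lim)
  then have "(\<lambda>n. F n a) \<longlonglongrightarrow> boundary_inner \<rho> f (szego_candidate \<rho> a)"
    by (simp add: szego_candidate_reproduces_continuous[OF F a])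
  then show "f a = boundary_inner \<rho> f (szego_candidate \<rho> a)"
    using pw[OF a] LIMSEQ_unique by blast
qed

lemma circle_parametrization:
  assumes "norm z = r"
  obtains t where "t \<in> {0..2*pi}" "z = of_real r * cis t"
proof
  show "Arg2pi z \<in> {0..2*pi}" using Arg2pi[of z] by auto
  show "z = of_real r * cis (Arg2pi z)" using Arg2pi_eq[of z] assms by (simp add: cis_conv_exp)
qed

lemma boundary_inner_self_eq_0:
  assumes d: "continuous_on (closed_ring \<rho> 1) d" and "boundary_inner \<rho> d d = 0"
    and z: "norm z = 1 \<or> norm z = \<rho>"
  shows "d z = 0"
proof -
  let ?M = "lebesgue_on {0..2*pi}"
  define J where "J r = (LINT t | ?M. (norm (d (of_real r * cis t)))\<^sup>2)" for r
  have J0: "J r \<ge> 0" for r unfolding J_def by (rule integral_nonneg_AE) auto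
  have "boundary_inner \<rho> d d = of_real (J 1 + \<rho> * J \<rho>)"
    unfolding boundary_inner_def arc_integral_def J_def
    by (simp add: complex_norm_square[symmetric] scaleR_conv_of_real flip: of_real_power)
  then have "J 1 + \<rho> * J \<rho> = 0" using assms(2) of_real_eq_0_iff by metis
  then have "J 1 = 0" "J \<rho> = 0"
    using J0[of 1] J0[of \<rho>] \<rho> by (smt (verit) mult_nonneg_nonneg mult_pos_pos)+
  then have J: "J (norm z) = 0" using z by auto
  have "continuous_on (sphere 0 (norm z)) d"
    by (rule continuous_on_subset[OF d]) (use z spheres_subset_closed_annulus in auto)
  then have "continuous_on {0..2*pi} (\<lambda>t. (norm (d (of_real (norm z) * cis t)))\<^sup>2)"
    by (intro continuous_intros continuous_on_circle) auto
  from integralL_eq_0_iff[OF this] J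
  have zero: "(norm (d (of_real (norm z) * cis t)))\<^sup>2 = 0" if "t \<in> {0..2*pi}" for t
    unfolding J_def using that by auto
  obtain t where "t \<in> {0..2*pi}" "z = of_real (norm z) * cis t"
    using circle_parametrization[of z] by blast
  with zero[of t] show ?thesis by simp
qed

text \<open>
  The difference \<open>d\<close> of two representers lies in the Hardy space, so both of them represent the same
  value \<open>d a\<close> and \<open>d\<close> is orthogonal to itself. Being continuous, it vanishes on the whole boundary,
  and the reproducing property of the candidate kernel carries this to the interior.
\<close>

lemma continuous_representer_unique:
  assumes k: "represents_evaluation \<rho> a k" "continuous_on (closed_ring \<rho> 1) k"
    and k': "represents_evaluation \<rho> a k'" "continuous_on (closed_ring \<rho> 1) k'"
    and z: "z \<in> closed_ring \<rho> 1"
  shows "k z = k' z"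
proof -
  define d where "d w = k w - k' w" for w
  have hol: "k holomorphic_on open_ring \<rho> 1" "k' holomorphic_on open_ring \<rho> 1"
    using k(1) k'(1) by (auto simp: represents_evaluation_def hardy_space_def annulus_eq_open_ring)
  have dc: "continuous_on (closed_ring \<rho> 1) d" and dh: "d holomorphic_on open_ring \<rho> 1"
    unfolding d_def by (intro continuous_intros holomorphic_intros k k' hol)+
  have cs: "continuous_on (sphere 0 r) h" if "r = 1 \<or> r = \<rho>" "continuous_on (closed_ring \<rho> 1) h"
    for r and h :: "complex \<Rightarrow> complex"
    by (rule continuous_on_subset[OF that(2)]) (use that(1) spheres_subset_closed_annulus in auto)
  have "d \<in> hardy_space \<rho>" by (rule continuous_imp_hardy[OF dc dh])
  then have "boundary_inner \<rho> d k = boundary_inner \<rho> d k'"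
    using k(1) k'(1) by (simp add: represents_evaluation_def)
  moreover have "boundary_inner \<rho> d d = boundary_inner \<rho> d k - boundary_inner \<rho> d k'"
  proof -
    have cm: "circle_mean r (\<lambda>w. d w * cnj (d w)) =
        circle_mean r (\<lambda>w. d w * cnj (k w)) - circle_mean r (\<lambda>w. d w * cnj (k' w))"
      if "r = 1 \<or> r = \<rho>" for r
    proof -
      have "(\<lambda>w. d w * cnj (d w)) = (\<lambda>w. d w * cnj (k w) - d w * cnj (k' w))"
        by (simp add: fun_eq_iff d_def algebra_simps)
      then show ?thesis
        using that \<rho> by (simp only:, intro circle_mean_diff continuous_intros cs that dc k k') auto
    qed
    have bi: "boundary_inner \<rho> d h = 2 * of_real pi * (circle_mean 1 (\<lambda>w. d w * cnj (h w)) +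
        of_real \<rho> * circle_mean \<rho> (\<lambda>w. d w * cnj (h w)))" if "continuous_on (closed_ring \<rho> 1) h" for h
      unfolding boundary_inner_def using \<rho>
      by (intro arc_integral_eq_circle_means continuous_intros cs dc that) auto
    have "circle_mean 1 (\<lambda>w. d w * cnj (d w)) =
        circle_mean 1 (\<lambda>w. d w * cnj (k w)) - circle_mean 1 (\<lambda>w. d w * cnj (k' w))"
      "circle_mean \<rho> (\<lambda>w. d w * cnj (d w)) =
        circle_mean \<rho> (\<lambda>w. d w * cnj (k w)) - circle_mean \<rho> (\<lambda>w. d w * cnj (k' w))"
      using cm by auto
    then show ?thesis
      unfolding bi[OF dc] bi[OF k(2)] bi[OF k'(2)] by (simp only: right_diff_distrib distrib_left) simp
  qed
  ultimately have "boundary_inner \<rho> d d = 0" by simp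
  then have bd: "d w = 0" if "norm w = 1 \<or> norm w = \<rho>" for w
    using boundary_inner_self_eq_0[OF dc _ that] by simp
  have "d z = 0"
  proof (cases "z \<in> open_ring \<rho> 1")
    case True
    have "d z = boundary_inner \<rho> d (szego_candidate \<rho> z)"
      by (rule szego_candidate_reproduces_continuous[OF dc dh True, symmetric])
    also have "\<dots> = 0"
      using bd \<rho> by (simp add: boundary_inner_def arc_integral_def norm_mult)
    finally show ?thesis .
  next
    case False
    then show ?thesis using z bd[of z] by (auto simp: closed_ring_def open_ring_def)
  qed
  then show ?thesis by (simp add: d_def)
qed

theorem szego_kernel_eq_series:
  assumes a: "a \<in> open_ring \<rho> 1" and z: "z \<in> closed_ring \<rho> 1"
  shows "szego_kernel \<rho> z a = szego_series \<rho> (cnj a * z) / (2 * of_real pi)"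
  unfolding szego_kernel_def closed_annulus_eq_closed_ring
proof (rule the_equality)
  show "\<exists>k. represents_evaluation \<rho> a k \<and> continuous_on (closed_ring \<rho> 1) k \<and>
      szego_series \<rho> (cnj a * z) / (2 * of_real pi) = k z"
    using szego_candidate_represents_evaluation[OF a] szego_candidate_regular(1)[OF a]
    by (intro exI[of _ "szego_candidate \<rho> a"]) (simp add: szego_candidate_def)
  fix w assume "\<exists>k. represents_evaluation \<rho> a k \<and> continuous_on (closed_ring \<rho> 1) k \<and> w = k z"
  then show "w = szego_series \<rho> (cnj a * z) / (2 * of_real pi)"
    using continuous_representer_unique[OF _ _ szego_candidate_represents_evaluation[OF a]
        szego_candidate_regular(1)[OF a] z] by (auto simp: szego_candidate_def)
qed

end

section \<open>The hypergeometric series, the infinite product and the zero\<close>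

lemma qshift_of_nat: "qshift \<alpha> q (int m) = (\<Prod>k<m. 1 - \<alpha> * of_real q ^ k)"
  by (simp add: qshift_def)

lemma qshift_minus_of_nat:
  "qshift \<alpha> q (- int m) = (\<Prod>k=1..m. inverse (1 - \<alpha> * of_real q powi (- int k)))"
  by (cases "m = 0") (simp_all add: qshift_def)

text \<open>
  Raising the parameter from \<open>\<alpha>\<close> to \<open>\<alpha> * q\<close> shifts every factor by one place, so the quotient of the
  two shifted factorials telescopes.
\<close>

lemma qshift_quotient:
  assumes q: "q \<noteq> 0" and nz: "\<And>k. 1 - \<alpha> * of_real q powi k \<noteq> 0"
  shows "qshift \<alpha> q n / qshift (\<alpha> * of_real q) q n = (1 - \<alpha>) / (1 - \<alpha> * of_real q powi n)"
proof -
  define d where "d k = 1 - \<alpha> * of_real q powi k" for k :: int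
  have d: "d k \<noteq> 0" for k using nz by (simp add: d_def)
  have num: "1 - \<alpha> * of_real q ^ k = d (int k)" for k by (simp add: d_def)
  have shift: "1 - \<alpha> * of_real q * of_real q powi k = d (k + 1)" for k
    using q by (simp add: d_def power_int_add mult_ac)
  have nonneg: "qshift \<alpha> q (int m) / qshift (\<alpha> * of_real q) q (int m) = d 0 / d (int m)" for m
  proof (induction m)
    case 0
    then show ?case using d by (simp add: qshift_def)
  next
    case (Suc m)
    have "qshift \<alpha> q (int (Suc m)) / qshift (\<alpha> * of_real q) q (int (Suc m)) =
        qshift \<alpha> q (int m) / qshift (\<alpha> * of_real q) q (int m) * (d (int m) / d (int m + 1))"
      using shift[of "int m"] unfolding qshift_of_nat by (simp add: num)
    also have "\<dots> = d 0 / d (int (Suc m))" unfolding Suc.IH using d by (simp add: add.commute)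
    finally show ?case .
  qed
  have neg: "qshift \<alpha> q (- int m) / qshift (\<alpha> * of_real q) q (- int m) = d 0 / d (- int m)" for m
  proof (induction m)
    case 0
    then show ?case using nonneg[of 0] by simp
  next
    case (Suc m)
    have "qshift \<alpha> q (- int (Suc m)) / qshift (\<alpha> * of_real q) q (- int (Suc m)) =
        qshift \<alpha> q (- int m) / qshift (\<alpha> * of_real q) q (- int m) * (d (- int m) / d (- int (Suc m)))"
    proof -
      have "1 - \<alpha> * of_real q powi (- 1 - int m) = d (- 1 - int m)" by (simp add: d_def)
      then show ?thesis
        using shift[of "- int (Suc m)"] unfolding qshift_minus_of_nat
        by (simp add: divide_inverse mult_ac)
    qed
    also have "\<dots> = d 0 / d (- int (Suc m))" unfolding Suc.IH using d by simp
    finally show ?case .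
  qed
  have "qshift \<alpha> q n / qshift (\<alpha> * of_real q) q n = d 0 / d n"
    using nonneg[of "nat n"] neg[of "nat (- n)"] by (cases "n \<ge> 0") auto
  then show ?thesis by (simp add: d_def)
qed

context
  fixes \<rho> :: real
  assumes \<rho>: "0 < \<rho>" "\<rho> < 1"
begin

lemma psi11_term_szego:
  "psi11_term (- of_real \<rho>) (- (of_real \<rho> ^ 3)) (\<rho>\<^sup>2) x n =
     (1 + of_real \<rho>) * (of_real (szego_coeff \<rho> n) * x powi n)"
proof -
  have pow: "1 + of_real \<rho> * of_real (\<rho>\<^sup>2) powi k = complex_of_real (1 + \<rho> powi (2 * k + 1))" for k
    using rho_powi_odd[OF \<rho>, of k] by simp
  have nz: "1 - (- of_real \<rho>) * complex_of_real (\<rho>\<^sup>2) powi k \<noteq> 0" for k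
  proof -
    have "1 + \<rho> powi (2 * k + 1) > 0" using \<rho> by (simp add: add_pos_pos)
    then show ?thesis using pow[of k] by (metis diff_minus_eq_add less_irrefl mult_minus_left of_real_eq_0_iff)
  qed
  have "- (of_real \<rho> ^ 3) = (- of_real \<rho>) * complex_of_real (\<rho>\<^sup>2)"
    by (simp add: power2_eq_square power3_eq_cube)
  then have "qshift (- of_real \<rho>) (\<rho>\<^sup>2) n / qshift (- (of_real \<rho> ^ 3)) (\<rho>\<^sup>2) n =
      (1 + of_real \<rho>) / (1 + of_real \<rho> * of_real (\<rho>\<^sup>2) powi n)"
    using qshift_quotient[of "\<rho>\<^sup>2" "- of_real \<rho>" n] nz \<rho> by simp
  also have "\<dots> = (1 + of_real \<rho>) * of_real (szego_coeff \<rho> n)"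
    unfolding pow by (simp add: szego_coeff_def)
  finally show ?thesis by (simp add: psi11_term_def)
qed

lemma has_sum_psi11_szego:
  assumes "\<rho>\<^sup>2 < norm x" "norm x < 1"
  shows "(psi11_term (- of_real \<rho>) (- (of_real \<rho> ^ 3)) (\<rho>\<^sup>2) x has_sum
           (1 + of_real \<rho>) * szego_series \<rho> x) UNIV"
  using has_sum_cmult_right[OF has_sum_szego_series[OF \<rho> assms], of "1 + of_real \<rho>"]
  unfolding psi11_term_szego[symmetric] .

lemma qpoch_inf_nonzero:
  assumes "norm y < 1"
  shows "qpoch_inf (\<rho>\<^sup>2) y \<noteq> 0"
proof
  assume "qpoch_inf (\<rho>\<^sup>2) y = 0"
  then obtain n where n: "y * of_real (\<rho>\<^sup>2) ^ n = 1"
    using qpoch_inf_eq_0_iff[OF rho_sq(1,2)[OF \<rho>]] by blast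
  have "norm (y * of_real (\<rho>\<^sup>2) ^ n) = norm y * (\<rho>\<^sup>2) ^ n"
    by (simp add: norm_mult norm_power)
  also have "\<dots> \<le> norm y * 1" using \<rho> by (intro mult_left_mono power_le_one) (auto simp: power_le_one)
  finally show False using n assms by simp
qed

lemma norm_rho_sq_divide_less_1:
  fixes x :: complex
  assumes "\<rho>\<^sup>2 < norm x"
  shows "norm (of_real (\<rho>\<^sup>2) / x) < 1"
proof -
  have "0 < norm x" using assms zero_le_power2[of \<rho>] by linarith
  then show ?thesis using assms by (simp add: norm_divide norm_power divide_less_eq_1)
qed

lemma theta_nonzero:
  assumes "\<rho>\<^sup>2 < norm x" "norm x < 1"
  shows "theta (\<rho>\<^sup>2) x \<noteq> 0"
  using qpoch_inf_nonzero assms(2) norm_rho_sq_divide_less_1[OF assms(1)] by (simp add: theta_def)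

lemma szego_series_eq_quotient:
  assumes x: "\<rho>\<^sup>2 < norm x" "norm x < 1"
  shows "szego_series \<rho> x = theta (\<rho>\<^sup>2) (- of_real \<rho> * x) * (qpoch_inf (\<rho>\<^sup>2) (of_real (\<rho>\<^sup>2)))\<^sup>2 /
         (theta (\<rho>\<^sup>2) x * (qpoch_inf (\<rho>\<^sup>2) (- of_real \<rho>))\<^sup>2)"
proof -
  have "theta (\<rho>\<^sup>2) x * (qpoch_inf (\<rho>\<^sup>2) (- of_real \<rho>))\<^sup>2 \<noteq> 0"
    using theta_nonzero[OF x] qpoch_inf_nonzero[of "- of_real \<rho>"] \<rho> by simp
  then show ?thesis
    using szego_series_eq_theta_quotient[OF \<rho> x] by (simp add: eq_divide_eq mult.assoc)
qed

text \<open>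
  The factors \<open>x + \<rho> ^ (2 * n + 1)\<close> and \<open>x - \<rho> ^ (2 * n + 2)\<close> are \<open>x\<close> times the factors in
  \<open>1 / x\<close> of the two theta products; the extra factors \<open>x\<close> cancel in the quotient.
\<close>

lemma has_prod_szego_factor:
  assumes x: "\<rho>\<^sup>2 < norm x" "norm x < 1"
  shows "szego_factor \<rho> x has_prod szego_series \<rho> x"
proof -
  have x0: "x \<noteq> 0" using x zero_le_power2[of \<rho>] by auto
  define P where "P y n = 1 - y * complex_of_real (\<rho>\<^sup>2) ^ n" for y n
  have P: "P y has_prod qpoch_inf (\<rho>\<^sup>2) y" for y
    unfolding P_def by (rule has_prod_qpoch_inf[OF rho_sq(1,2)[OF \<rho>]])
  let ?q = "complex_of_real (\<rho>\<^sup>2)" and ?r = "- complex_of_real \<rho>"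
  have "(\<lambda>n. P (?r * x) n * P (?q / (?r * x)) n * (P ?q n)\<^sup>2 / (P x n * P (?q / x) n * (P ?r n)\<^sup>2)) has_prod
     (qpoch_inf (\<rho>\<^sup>2) (?r * x) * qpoch_inf (\<rho>\<^sup>2) (?q / (?r * x)) * (qpoch_inf (\<rho>\<^sup>2) ?q)\<^sup>2 /
      (qpoch_inf (\<rho>\<^sup>2) x * qpoch_inf (\<rho>\<^sup>2) (?q / x) * (qpoch_inf (\<rho>\<^sup>2) ?r)\<^sup>2))"
    by (intro has_prod_divide has_prod_mult has_prod_power P)
  also have "\<dots> = szego_series \<rho> x"
    unfolding szego_series_eq_quotient[OF x] theta_def ..
  also have "(\<lambda>n. P (?r * x) n * P (?q / (?r * x)) n * (P ?q n)\<^sup>2 / (P x n * P (?q / x) n * (P ?r n)\<^sup>2)) =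
      szego_factor \<rho> x"
  proof
    fix n
    define w where "w = complex_of_real \<rho> ^ (2 * n)"
    have w: "?q ^ n = w" by (simp add: w_def power_mult)
    have e: "complex_of_real \<rho> ^ (2 * n + 1) = of_real \<rho> * w"
      "complex_of_real \<rho> ^ (2 * n + 2) = ?q * w"
      by (simp_all add: w_def power2_eq_square)
    have "?q / (?r * x) = - of_real \<rho> / x"
      using x0 \<rho> by (simp add: power2_eq_square)
    then have "P (?q / (?r * x)) n = (x + of_real \<rho> * w) / x"
      using x0 by (simp only: P_def w) (simp add: field_simps)
    moreover have "P (?q / x) n = (x - ?q * w) / x"
      using x0 by (simp only: P_def w) (simp add: field_simps)
    moreover have "P (?r * x) n = 1 + x * (of_real \<rho> * w)" "P ?q n = 1 - ?q * w" "P x n = 1 - x * w"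
      "P ?r n = 1 + of_real \<rho> * w"
      by (simp_all only: P_def w) simp_all
    ultimately show "P (?r * x) n * P (?q / (?r * x)) n * (P ?q n)\<^sup>2 / (P x n * P (?q / x) n * (P ?r n)\<^sup>2) =
      szego_factor \<rho> x n"
      unfolding szego_factor_def e w_def[symmetric] using x0 by simp
  qed
  finally show ?thesis .
qed

text \<open>
  Among the factors of the numerator, those in \<open>x\<close> have \<open>norm (\<rho> * x) < 1\<close> and cannot vanish, and
  those in \<open>1 / x\<close> vanish at \<open>- \<rho> * \<rho> ^ (2 * n)\<close>; only \<open>n = 0\<close> gives a point with
  \<open>\<rho>\<^sup>2 < norm x\<close>.
\<close>

lemma szego_series_eq_0_iff:
  assumes x: "\<rho>\<^sup>2 < norm x" "norm x < 1"
  shows "szego_series \<rho> x = 0 \<longleftrightarrow> x = - of_real \<rho>"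
proof -
  have x0: "x \<noteq> 0" using x zero_le_power2[of \<rho>] by auto
  have quot: "of_real (\<rho>\<^sup>2) / (- of_real \<rho> * x) = - of_real \<rho> / x"
    using \<rho> x0 by (simp add: power2_eq_square)
  have "szego_series \<rho> x = 0 \<longleftrightarrow> theta (\<rho>\<^sup>2) (- of_real \<rho> * x) = 0"
    using szego_series_eq_quotient[OF x] theta_nonzero[OF x] qpoch_inf_nonzero[of "- of_real \<rho>"]
      qpoch_inf_nonzero[of "of_real (\<rho>\<^sup>2)"] \<rho> rho_sq[OF \<rho>] by (simp add: norm_power)
  also have "\<dots> \<longleftrightarrow> qpoch_inf (\<rho>\<^sup>2) (- of_real \<rho> / x) = 0"
  proof -
    have "norm (- of_real \<rho> * x) < 1"
      using \<rho> x mult_strict_mono[of \<rho> 1 "norm x" 1] by (simp add: norm_mult)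
    then show ?thesis using qpoch_inf_nonzero unfolding theta_def quot by simp
  qed
  also have "\<dots> \<longleftrightarrow> (\<exists>n. - of_real \<rho> / x * of_real (\<rho>\<^sup>2) ^ n = 1)"
    by (rule qpoch_inf_eq_0_iff[OF rho_sq(1,2)[OF \<rho>]])
  also have "\<dots> \<longleftrightarrow> x = - of_real \<rho>"
  proof
    assume "\<exists>n. - of_real \<rho> / x * of_real (\<rho>\<^sup>2) ^ n = 1"
    then obtain n where "- of_real \<rho> / x * of_real (\<rho>\<^sup>2) ^ n = 1" ..
    then have xn: "x = - of_real \<rho> * of_real (\<rho>\<^sup>2) ^ n" using x0 by (simp add: field_simps)
    have "n = 0"
    proof (rule ccontr)
      assume "n \<noteq> 0"
      then have "(\<rho>\<^sup>2) ^ n \<le> (\<rho>\<^sup>2) ^ 1"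
        using rho_sq[OF \<rho>] by (intro power_decreasing) auto
      then have "\<rho> * (\<rho>\<^sup>2) ^ n \<le> 1 * (\<rho>\<^sup>2)" using \<rho> by (intro mult_mono) auto
      moreover have "norm x = \<rho> * (\<rho>\<^sup>2) ^ n" using \<rho> by (simp add: xn norm_mult norm_power)
      ultimately show False using x(1) by simp
    qed
    then show "x = - of_real \<rho>" using xn by simp
  next
    assume "x = - of_real \<rho>"
    then show "\<exists>n. - of_real \<rho> / x * of_real (\<rho>\<^sup>2) ^ n = 1"
      using \<rho> by (intro exI[of _ 0]) simp
  qed
  finally show ?thesis .
qed

end

theorem theorem1:
  fixes \<rho> :: real
  assumes "0 < \<rho>" and "\<rho> < 1"
  shows
    "(\<forall>a\<in>annulus \<rho>. \<forall>z\<in>annulus \<rho> \<union> annulus_boundary \<rho>.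
        psi11_term (- of_real \<rho>) (- (of_real \<rho> ^ 3)) (\<rho>\<^sup>2) (cnj a * z) summable_on UNIV \<and>
        szego_kernel \<rho> z a =
          1 / (2 * of_real pi * (1 + of_real \<rho>)) *
          psi11 (- of_real \<rho>) (- (of_real \<rho> ^ 3)) (\<rho>\<^sup>2) (cnj a * z)) \<and>
     (\<forall>a\<in>annulus \<rho>. \<forall>z\<in>annulus \<rho> \<union> annulus_boundary \<rho>.
        convergent_prod (szego_factor \<rho> (cnj a * z)) \<and>
        szego_kernel \<rho> z a =
          1 / (2 * of_real pi) * (\<Prod>n. szego_factor \<rho> (cnj a * z) n)) \<and>
     (\<forall>a\<in>annulus \<rho>.
        {z \<in> annulus \<rho>. szego_kernel \<rho> z a = 0} = {z. cnj a * z + of_real \<rho> = 0} \<and>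
        {z \<in> annulus \<rho>. szego_kernel \<rho> z a = 0} = {- of_real \<rho> / cnj a})"
proof -
  note \<rho> = assms
  have psi: "psi11_term (- of_real \<rho>) (- (of_real \<rho> ^ 3)) (\<rho>\<^sup>2) (cnj a * z) summable_on UNIV \<and>
        szego_kernel \<rho> z a =
          1 / (2 * of_real pi * (1 + of_real \<rho>)) *
          psi11 (- of_real \<rho>) (- (of_real \<rho> ^ 3)) (\<rho>\<^sup>2) (cnj a * z)"
    if az: "a \<in> annulus \<rho>" "z \<in> annulus \<rho> \<union> annulus_boundary \<rho>" for a z
  proof -
    have az': "a \<in> open_ring \<rho> 1" "z \<in> closed_ring \<rho> 1"
      using az unfolding closed_annulus_eq_closed_ring[OF \<rho>] unfolding annulus_eq_open_ring
      by simp_all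
    have "1 + complex_of_real \<rho> \<noteq> 0"
      using \<rho> by (metis add_pos_pos less_irrefl of_real_1 of_real_add of_real_eq_0_iff zero_less_one)
    then show ?thesis
      using has_sum_psi11_szego[OF \<rho> norm_cnj_mult_bounds[OF \<rho> az']] szego_kernel_eq_series[OF \<rho> az']
      by (auto simp: psi11_def has_sum_iff)
  qed
  have prod: "convergent_prod (szego_factor \<rho> (cnj a * z)) \<and>
        szego_kernel \<rho> z a = 1 / (2 * of_real pi) * (\<Prod>n. szego_factor \<rho> (cnj a * z) n)"
    if az: "a \<in> annulus \<rho>" "z \<in> annulus \<rho> \<union> annulus_boundary \<rho>" for a z
  proof -
    have az': "a \<in> open_ring \<rho> 1" "z \<in> closed_ring \<rho> 1"
      using az unfolding closed_annulus_eq_closed_ring[OF \<rho>] unfolding annulus_eq_open_ring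
      by simp_all
    show ?thesis
      using has_prod_szego_factor[OF \<rho> norm_cnj_mult_bounds[OF \<rho> az']] szego_kernel_eq_series[OF \<rho> az']
      by (simp add: has_prod_iff)
  qed
  have zeros: "{z \<in> annulus \<rho>. szego_kernel \<rho> z a = 0} = {z. cnj a * z + of_real \<rho> = 0}"
      "{z. cnj a * z + of_real \<rho> = 0} = {- of_real \<rho> / cnj a}"
    if "a \<in> annulus \<rho>" for a
  proof -
    have a: "a \<in> open_ring \<rho> 1" using that by (simp only: annulus_eq_open_ring)
    have na: "\<rho> < norm a" "norm a < 1" using a by (auto simp: open_ring_def)
    then have a0: "a \<noteq> 0" using \<rho> by auto
    have "szego_kernel \<rho> z a = 0 \<longleftrightarrow> cnj a * z = - of_real \<rho>" if "z \<in> open_ring \<rho> 1" for z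
    proof -
      have z: "z \<in> closed_ring \<rho> 1" using that by (auto simp: open_ring_def closed_ring_def)
      show ?thesis
        unfolding szego_kernel_eq_series[OF \<rho> a z]
        using szego_series_eq_0_iff[OF \<rho> norm_cnj_mult_bounds[OF \<rho> a z]] by simp
    qed
    moreover have "z \<in> open_ring \<rho> 1" if "cnj a * z = - of_real \<rho>" for z
    proof -
      have "norm a * norm z = \<rho>"
        using arg_cong[OF that, of norm] \<rho> by (simp add: norm_mult)
      then have "norm z = \<rho> / norm a" using a0 by (simp add: field_simps)
      moreover have "\<rho> < \<rho> / norm a" "\<rho> / norm a < 1"
        using na \<rho> a0 by (simp_all add: less_divide_eq)
      ultimately show ?thesis by (simp add: open_ring_def)
    qed
    ultimately show "{z \<in> annulus \<rho>. szego_kernel \<rho> z a = 0} = {z. cnj a * z + of_real \<rho> = 0}"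
      unfolding annulus_eq_open_ring add_eq_0_iff2 by blast
    show "{z. cnj a * z + of_real \<rho> = 0} = {- of_real \<rho> / cnj a}"
      using a0 by (auto simp: add_eq_0_iff2 field_simps)
  qed
  show ?thesis
    by (intro conjI ballI) (use psi prod zeros in blast)+
qed

end
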